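(* Let $p$ be a positive integer. Every digraph $D=(V,A)$ with minimum dicut size $\tau$ whose underlying undirected graph is $6p$-edge-connected contains $\lfloor \tau p/(2p+1)\rfloor$ pairwise arc-disjoint dijoins.
   Context: All graphs and digraphs are finite and loopless; parallel edges/arcs are allowed. For $\emptyset\neq U\subsetneq V$, $\delta^+_D(U)$ (resp. $\delta^-_D(U)$) denotes the set of arcs leaving (resp. entering) $U$. A dicut is an arc set $\delta^+_D(U)$ with $\emptyset\neq U\subsetneq V$ and $\delta^-_D(U)=\emptyset$. A dijoin is an arc subset intersecting every dicut. "$D$ has minimum dicut size $\tau$" means $D$ has at least one dicut and the minimum number of arcs in a dicut is $\tau$. The underlying undirected graph of $D$ is obtained by replacing each arc $(u,v)$ by an edge $\{u,v\}$. *)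

theory Defs
  imports Main
begin

text \<open>A digraph D = (V, A) with parallel arcs allowed: arcs are abstract identifiers
  in a finite set A, with tail and head maps. Loopless: tail a \<noteq> head a.\<close>

definition digraph :: "'v set \<Rightarrow> 'a set \<Rightarrow> ('a \<Rightarrow> 'v) \<Rightarrow> ('a \<Rightarrow> 'v) \<Rightarrow> bool" where
  "digraph V A tail head \<longleftrightarrow> finite V \<and> finite A \<and>
     (\<forall>a\<in>A. tail a \<in> V \<and> head a \<in> V \<and> tail a \<noteq> head a)"

definition out_arcs :: "'a set \<Rightarrow> ('a \<Rightarrow> 'v) \<Rightarrow> ('a \<Rightarrow> 'v) \<Rightarrow> 'v set \<Rightarrow> 'a set" where
  "out_arcs A tail head U = {a\<in>A. tail a \<in> U \<and> head a \<notin> U}"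

definition in_arcs :: "'a set \<Rightarrow> ('a \<Rightarrow> 'v) \<Rightarrow> ('a \<Rightarrow> 'v) \<Rightarrow> 'v set \<Rightarrow> 'a set" where
  "in_arcs A tail head U = {a\<in>A. head a \<in> U \<and> tail a \<notin> U}"

definition is_dicut :: "'v set \<Rightarrow> 'a set \<Rightarrow> ('a \<Rightarrow> 'v) \<Rightarrow> ('a \<Rightarrow> 'v) \<Rightarrow> 'a set \<Rightarrow> bool" where
  "is_dicut V A tail head C \<longleftrightarrow> (\<exists>U. U \<noteq> {} \<and> U \<subset> V \<and> in_arcs A tail head U = {} \<and> C = out_arcs A tail head U)"

definition is_dijoin :: "'v set \<Rightarrow> 'a set \<Rightarrow> ('a \<Rightarrow> 'v) \<Rightarrow> ('a \<Rightarrow> 'v) \<Rightarrow> 'a set \<Rightarrow> bool" where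
  "is_dijoin V A tail head J \<longleftrightarrow> J \<subseteq> A \<and> (\<forall>C. is_dicut V A tail head C \<longrightarrow> J \<inter> C \<noteq> {})"

definition min_dicut_size :: "'v set \<Rightarrow> 'a set \<Rightarrow> ('a \<Rightarrow> 'v) \<Rightarrow> ('a \<Rightarrow> 'v) \<Rightarrow> nat \<Rightarrow> bool" where
  "min_dicut_size V A tail head \<tau> \<longleftrightarrow>
     (\<exists>C. is_dicut V A tail head C \<and> card C = \<tau>) \<and>
     (\<forall>C. is_dicut V A tail head C \<longrightarrow> \<tau> \<le> card C)"

definition underlying_k_edge_connected :: "'v set \<Rightarrow> 'a set \<Rightarrow> ('a \<Rightarrow> 'v) \<Rightarrow> ('a \<Rightarrow> 'v) \<Rightarrow> nat \<Rightarrow> bool" where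
  "underlying_k_edge_connected V A tail head k \<longleftrightarrow>
     (\<forall>U. U \<noteq> {} \<and> U \<subset> V \<longrightarrow> k \<le> card (out_arcs A tail head U \<union> in_arcs A tail head U))"

end

theory Submission
  imports Defs
begin

text \<open>
  Suppose the arcs of \<open>D\<close> carry an integer flow with absolute values in \<open>{p, p + 1}\<close>. In a dicut
  the positive and the negative arcs then balance, so each of the two classes has at least
  \<open>m = \<lfloor>\<tau> p / (2 p + 1)\<rfloor>\<close> arcs there. Take \<open>m\<close> copies of \<open>D\<close> and add the reversals of the positive
  arcs: every nonempty vertex set avoiding a root \<open>r\<close> is entered by \<open>m\<close> arcs, and Edmonds' theorem yields \<open>m\<close>
  disjoint out-branchings. The negative arcs yield \<open>m\<close> in-branchings in the same way. The reversed
  arcs used by the \<open>i\<close>-th out- and the \<open>i\<close>-th in-branching make \<open>D\<close> strongly connected and hence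
  form a dijoin.

  The flow comes from an orientation with \<open>outdegree - indegree\<close> divisible by \<open>k = 2 p + 1\<close>
  everywhere (Lovasz, Thomassen, Wu and Zhang). Its existence is shown for prescribed boundaries by
  induction: tight vertex sets are contracted, vertices of boundary 0 are split off, and edges are
  oriented and deleted. A distinguished root with prescribed orientation keeps the two halves of a
  contraction compatible.
\<close>

subsection \<open>Orientations with prescribed boundary modulo \<open>k\<close>\<close>

text \<open>The invariant of the induction asks every set for degree at least \<open>2*k - 2\<close>
  plus the distance of its boundary from the multiples of \<open>2*k\<close>. Deleting an edge
  lowers the degrees of its ends and shifts their boundaries by 1. Once no proper subset with two or
  more vertices is tight, parity leaves each of them a surplus of 2, which absorbs both changes. A
  single vertex may have no surplus, so its distance has to fall along with its degree: the edge
  must run from a vertex with residue in the lower half modulo \<open>2*k\<close> to one with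
  residue in the upper half. This fails at vertices of distance 0, hence the splitting off, and also
  when all residues lie in one half; then new root arcs carry one vertex into the other half. The
  connectivity \<open>6 * p\<close> is the initial price of the invariant: with
  \<open>k = 2*p + 1\<close> it asks for \<open>4*p\<close> plus a distance of at most
  \<open>2*p + 1\<close>. The full \<open>6*p + 1\<close> is asked only of sets of odd degree, which
  have it as soon as they have \<open>6*p\<close>.\<close>

definition mod_dist :: "int \<Rightarrow> int \<Rightarrow> int" where
  "mod_dist k x = min (x mod (2*k)) (2*k - x mod (2*k))"

text \<open>Together with \<open>mod_dist_attained\<close> this identifies the formula:
  \<open>mod_dist k x\<close> is the distance from \<open>x\<close> to the nearest multiple of
  \<open>2*k\<close>.\<close>

lemma mod_dist_le:
  assumes "k > 0" shows "mod_dist k x \<le> \<bar>x - 2*k*j\<bar>"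
proof -
  define q r where "q = x div (2*k)" and "r = x mod (2*k)"
  have x: "x = 2*k*q + r" by (simp add: q_def r_def)
  have r: "0 \<le> r" "r < 2*k" using assms by (auto simp: r_def)
  show ?thesis
  proof (cases "j \<le> q")
    case True
    have "x - 2*k*j = r + 2*k*(q-j)" by (simp add: x algebra_simps)
    moreover have "2*k*(q-j) \<ge> 0" using True assms by simp
    ultimately show ?thesis using r by (simp add: mod_dist_def r_def[symmetric])
  next
    case False
    have "2*k*j - x = (2*k - r) + 2*k*(j-q-1)" by (simp add: x algebra_simps)
    moreover have "2*k*(j-q-1) \<ge> 0" using False assms by simp
    ultimately show ?thesis using r by (simp add: mod_dist_def r_def[symmetric])
  qed
qed

lemma mod_dist_attained:
  assumes "k > 0" obtains j where "mod_dist k x = \<bar>x - 2*k*j\<bar>"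
proof -
  define q r where "q = x div (2*k)" and "r = x mod (2*k)"
  have x: "x = 2*k*q + r" by (simp add: q_def r_def)
  have r: "0 \<le> r" "r < 2*k" using assms by (auto simp: r_def)
  have 1: "x - 2*k*q = r" by (simp add: x)
  have 2: "x - 2*k*(q+1) = r - 2*k" by (simp add: x algebra_simps)
  show ?thesis
  proof (cases "r \<le> k")
    case True
    with r 1 show ?thesis by (intro that[of q]) (auto simp: mod_dist_def r_def[symmetric])
  next
    case False
    with r 2 show ?thesis by (intro that[of "q+1"]) (auto simp: mod_dist_def r_def[symmetric])
  qed
qed

lemma mod_dist_nonneg: "k > 0 \<Longrightarrow> 0 \<le> mod_dist k x"
  by (metis mod_dist_attained abs_ge_zero)

lemma mod_dist_le_k: "k > 0 \<Longrightarrow> mod_dist k x \<le> k"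
  by (auto simp: mod_dist_def)

lemma mod_dist_add_le:
  assumes "k > 0" shows "mod_dist k (x + y) \<le> mod_dist k x + \<bar>y\<bar>"
proof -
  obtain j where "mod_dist k x = \<bar>x - 2*k*j\<bar>" using mod_dist_attained assms by blast
  then show ?thesis using mod_dist_le[OF assms, of "x+y" j] by linarith
qed

text \<open>The nearest multiple of \<open>2*k\<close> is even. Degrees and distances of the same
  set therefore agree in parity, which is what later turns a surplus of 1 into a surplus of
  2.\<close>

lemma mod_dist_parity: "k > 0 \<Longrightarrow> even (mod_dist k x - x)"
proof -
  assume k: "k > 0"
  obtain j where "mod_dist k x = \<bar>x - 2*k*j\<bar>" using mod_dist_attained k by blast
  then show ?thesis by (auto simp: abs_if)
qed

lemma mod_dist_cong: "2*k dvd x - y \<Longrightarrow> mod_dist k x = mod_dist k y"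
  unfolding mod_dist_def by (metis mod_eq_dvd_iff)

lemma mod_dist_subadd:
  assumes "k > 0" shows "mod_dist k (x + y) \<le> mod_dist k x + mod_dist k y"
proof -
  obtain j where j: "mod_dist k y = \<bar>y - 2*k*j\<bar>" using mod_dist_attained assms by blast
  have "mod_dist k (x + y) = mod_dist k (x + (y - 2*k*j))" by (rule mod_dist_cong) simp
  also have "\<dots> \<le> mod_dist k x + mod_dist k y" unfolding j by (rule mod_dist_add_le[OF assms])
  finally show ?thesis .
qed

lemma mod_dist_uminus:
  assumes "k > 0" shows "mod_dist k (- x) = mod_dist k x"
proof -
  have "mod_dist k (-y) \<le> mod_dist k y" for y
  proof -
    obtain j where "mod_dist k y = \<bar>y - 2*k*j\<bar>" using mod_dist_attained assms by blast
    then show ?thesis using mod_dist_le[OF assms, of "-y" "-j"] by simp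
  qed
  from this[of x] this[of "-x"] show ?thesis by simp
qed

lemma mod_dist_eq_0:
  assumes "k > 0" shows "mod_dist k x = 0 \<longleftrightarrow> 2*k dvd x"
proof -
  define r where "r = x mod (2*k)"
  have "0 \<le> r" "r < 2*k" using assms by (auto simp: r_def)
  then have "min r (2*k - r) = 0 \<longleftrightarrow> r = 0" by linarith
  then show ?thesis by (simp add: mod_dist_def r_def mod_eq_0_iff_dvd)
qed

lemma mod_dist_le_abs: "k > 0 \<Longrightarrow> mod_dist k x \<le> \<bar>x\<bar>"
  using mod_dist_le[of k x 0] by simp

lemma mod_dist_eq_abs:
  assumes "k > 0" "\<bar>x\<bar> \<le> k" shows "mod_dist k x = \<bar>x\<bar>"
proof -
  obtain j where j: "mod_dist k x = \<bar>x - 2*k*j\<bar>" using mod_dist_attained assms by blast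
  have "\<bar>x\<bar> \<le> \<bar>x - 2*k*j\<bar>"
  proof (cases "j = 0")
    case False
    then have "\<bar>2*k*j\<bar> \<ge> 2*k" using assms by (simp add: abs_mult)
    then show ?thesis using assms by linarith
  qed simp
  then show ?thesis using j mod_dist_le_abs[OF assms(1), of x] by linarith
qed

lemma mod_dist_mod_le:
  assumes "k > 0" "x mod (2*k) \<le> k" shows "mod_dist k x = x mod (2*k)"
  using assms by (simp add: mod_dist_def)

lemma mod_dist_shift:
  assumes "k > 0" "\<bar>x mod (2*k) + y\<bar> \<le> k" shows "mod_dist k (x + y) = \<bar>x mod (2*k) + y\<bar>"
proof -
  have "2*k dvd (x + y) - (x mod (2*k) + y)"
    by (simp add: minus_mod_eq_mult_div)
  from mod_dist_cong[OF this] mod_dist_eq_abs[OF assms] show ?thesis by simp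
qed

text \<open>A nonzero residue in the lower half gets closer to 0 when lowered; by
  \<open>mod_dist_succ\<close> one in the upper half gets closer when raised. The residue
  \<open>k\<close> is accepted by both lemmas.\<close>

lemma mod_dist_pred: "k > 0 \<Longrightarrow> \<not> 2*k dvd x \<Longrightarrow> x mod (2*k) \<le> k \<Longrightarrow> mod_dist k (x - 1) = mod_dist k x - 1"
proof -
  assume k: "k > 0" and nd: "\<not> 2*k dvd x" and le: "x mod (2*k) \<le> k"
  have "x mod (2*k) \<noteq> 0" using nd by (simp add: mod_eq_0_iff_dvd)
  moreover have "x mod (2*k) \<ge> 0" using k by simp
  ultimately have "1 \<le> x mod (2*k)" by linarith
  then show ?thesis using mod_dist_shift[OF k, of x "-1"] mod_dist_mod_le[OF k le] le by simp
qed

lemma mod_dist_succ: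
  assumes k: "k > 0" and le: "k \<le> x mod (2*k)"
  shows "mod_dist k (x + 1) = mod_dist k x - 1"
proof -
  have lt: "x mod (2*k) < 2*k" using k by simp
  have "mod_dist k (x + 1) = mod_dist k (x + (1 - 2*k))" by (rule mod_dist_cong) simp
  also have "\<dots> = \<bar>x mod (2*k) + (1 - 2*k)\<bar>" using lt le by (intro mod_dist_shift[OF k]) auto
  also have "\<dots> = 2*k - x mod (2*k) - 1" using lt by simp
  finally show ?thesis using le k by (simp add: mod_dist_def)
qed

section \<open>Cuts, boundaries and instances with a root\<close>

definition cut :: "'e set \<Rightarrow> ('e \<Rightarrow> 'v) \<Rightarrow> ('e \<Rightarrow> 'v) \<Rightarrow> 'v set \<Rightarrow> int" where
  "cut E s t A = (\<Sum>e\<in>E. of_bool ((s e \<in> A) \<noteq> (t e \<in> A)))"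

definition net :: "'e set \<Rightarrow> ('e \<Rightarrow> 'v) \<Rightarrow> ('e \<Rightarrow> 'v) \<Rightarrow> ('e \<Rightarrow> int) \<Rightarrow> 'v \<Rightarrow> int" where
  "net E s t \<epsilon> v = (\<Sum>e\<in>E. \<epsilon> e * (of_bool (s e = v) - of_bool (t e = v)))"

text \<open>This is the degree in the graph with the root added: the root lies outside
  \<open>A\<close>, so every root arc at a vertex of \<open>A\<close> crosses.\<close>

definition deg :: "'e set \<Rightarrow> ('e \<Rightarrow> 'v) \<Rightarrow> ('e \<Rightarrow> 'v) \<Rightarrow> ('v \<Rightarrow> int) \<Rightarrow> ('v \<Rightarrow> int) \<Rightarrow> 'v set \<Rightarrow> int" where
  "deg E s t p q A = cut E s t A + sum p A + sum q A"

lemma sum_upd: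
  fixes f :: "'v \<Rightarrow> int"
  assumes "finite A" shows "sum (f(v := c)) A = sum f A + (if v \<in> A then c - f v else 0)"
proof (cases "v \<in> A")
  case True
  have "sum (f(v := c)) A = (f(v := c)) v + sum (f(v := c)) (A - {v})"
    using assms True by (rule sum.remove)
  also have "sum (f(v := c)) (A - {v}) = sum f (A - {v})" by (rule sum.cong) auto
  finally show ?thesis using sum.remove[OF assms True, of f] True by simp
next
  case False
  then show ?thesis by (auto intro!: sum.cong)
qed

lemma cut_remove:
  assumes "finite E" "e \<in> E"
  shows "cut (E - {e}) s t A = cut E s t A - of_bool ((s e \<in> A) \<noteq> (t e \<in> A))"
  unfolding cut_def using sum.remove[OF assms, of "\<lambda>e. of_bool ((s e \<in> A) \<noteq> (t e \<in> A))::int"] by simp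

lemma net_remove:
  assumes "finite E" "e \<in> E"
  shows "net (E - {e}) s t \<epsilon> v = net E s t \<epsilon> v - \<epsilon> e * (of_bool (s e = v) - of_bool (t e = v))"
  unfolding net_def using sum.remove[OF assms, of "\<lambda>e. \<epsilon> e * (of_bool (s e = v) - of_bool (t e = v))"] by simp

lemma net_cong:
  assumes "\<And>e. e \<in> E \<Longrightarrow> s e = s' e \<and> t e = t' e \<and> \<epsilon> e = \<epsilon>' e"
  shows "net E s t \<epsilon> v = net E s' t' \<epsilon>' v"
  unfolding net_def using assms by (intro sum.cong) auto

lemma cut_cong:
  assumes "\<And>e. e \<in> E \<Longrightarrow> s e = s' e \<and> t e = t' e"
  shows "cut E s t A = cut E s' t' A"
  unfolding cut_def using assms by (intro sum.cong) auto

lemma sum_of_bool_eq: "finite A \<Longrightarrow> (\<Sum>v\<in>A. of_bool (x = v) :: int) = of_bool (x \<in> A)"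
  by (simp add: of_bool_def)

lemma sum_net:
  assumes "finite A"
  shows "(\<Sum>v\<in>A. net E s t \<epsilon> v) = (\<Sum>e\<in>E. \<epsilon> e * (of_bool (s e \<in> A) - of_bool (t e \<in> A)))"
proof -
  have "(\<Sum>v\<in>A. net E s t \<epsilon> v) = (\<Sum>e\<in>E. \<Sum>v\<in>A. \<epsilon> e * (of_bool (s e = v) - of_bool (t e = v)))"
    unfolding net_def by (rule sum.swap)
  also have "\<dots> = (\<Sum>e\<in>E. \<epsilon> e * (of_bool (s e \<in> A) - of_bool (t e \<in> A)))"
    by (simp add: sum_distrib_left[symmetric] sum_subtractf sum_of_bool_eq[OF assms])
  finally show ?thesis .
qed

text \<open>
  The vertex set is \<open>W\<close> together with an implicit root: \<open>p v\<close> arcs lead from the root to \<open>v\<close> and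
  \<open>q v\<close> arcs from \<open>v\<close> to the root. The required boundary \<open>b\<close> counts the root arcs as well. Edges in
  \<open>E\<close> are undirected (\<open>s\<close> and \<open>t\<close> only name the ends; loops arise from contractions) and
  \<open>\<epsilon> e = 1\<close> orients \<open>e\<close> from \<open>s e\<close> to \<open>t e\<close>. Since the parity of \<open>b\<close> is fixed, working modulo \<open>2 k\<close>
  and modulo \<open>k\<close> amounts to the same.
\<close>

definition solvable :: "int \<Rightarrow> 'v set \<Rightarrow> 'e set \<Rightarrow> ('e \<Rightarrow> 'v) \<Rightarrow> ('e \<Rightarrow> 'v) \<Rightarrow> ('v \<Rightarrow> int) \<Rightarrow> ('v \<Rightarrow> int) \<Rightarrow> ('v \<Rightarrow> int) \<Rightarrow> bool" where
  "solvable k W E s t p q b \<longleftrightarrow> (\<exists>\<epsilon>. (\<forall>e\<in>E. \<epsilon> e = 1 \<or> \<epsilon> e = -1) \<and>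
     (\<forall>v\<in>W. 2*k dvd net E s t \<epsilon> v - (b v + p v - q v)))"

text \<open>
  The exemption of the single vertex \<open>w\<close>, if it has boundary 0, allows it to be split off edge
  by edge.
\<close>

definition admissible :: "int \<Rightarrow> 'v set \<Rightarrow> 'e set \<Rightarrow> ('e \<Rightarrow> 'v) \<Rightarrow> ('e \<Rightarrow> 'v) \<Rightarrow> ('v \<Rightarrow> int) \<Rightarrow> ('v \<Rightarrow> int) \<Rightarrow> ('v \<Rightarrow> int) \<Rightarrow> 'v \<Rightarrow> bool" where
  "admissible k W E s t p q b w \<longleftrightarrow> finite W \<and> finite E \<and> (\<forall>e\<in>E. s e \<in> W \<and> t e \<in> W) \<and>
     (\<forall>v\<in>W. p v \<ge> 0 \<and> q v \<ge> 0) \<and>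
     (\<forall>A\<subseteq>W. even (deg E s t p q A - sum b A)) \<and>
     2*k dvd sum b W + sum p W - sum q W \<and>
     sum p W + sum q W \<le> 2*k - 2 + mod_dist k (sum b W) \<and>
     (\<forall>A. A \<noteq> {} \<longrightarrow> A \<subset> W \<longrightarrow> \<not> (A = {w} \<and> 2*k dvd b w) \<longrightarrow>
        2*k - 2 + mod_dist k (sum b A) \<le> deg E s t p q A)"

lemma admissibleD:
  assumes "admissible k W E s t p q b w"
  shows "finite W" "finite E" "\<And>e. e \<in> E \<Longrightarrow> s e \<in> W" "\<And>e. e \<in> E \<Longrightarrow> t e \<in> W"
    "\<And>v. v \<in> W \<Longrightarrow> p v \<ge> 0" "\<And>v. v \<in> W \<Longrightarrow> q v \<ge> 0"
    "\<And>A. A \<subseteq> W \<Longrightarrow> even (deg E s t p q A - sum b A)"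
    "2*k dvd sum b W + sum p W - sum q W"
    "sum p W + sum q W \<le> 2*k - 2 + mod_dist k (sum b W)"
    "\<And>A. A \<noteq> {} \<Longrightarrow> A \<subset> W \<Longrightarrow> \<not> (A = {w} \<and> 2*k dvd b w) \<Longrightarrow> 2*k - 2 + mod_dist k (sum b A) \<le> deg E s t p q A"
  using assms unfolding admissible_def by (elim conjE; (drule spec)?; simp only: simp_thms Ball_def)+

text \<open>Reversing all arcs exchanges \<open>p\<close> with \<open>q\<close> and negates
  \<open>b\<close>, while distances to multiples of \<open>2*k\<close> are even functions. With
  \<open>solvable_flip\<close> this halves the case analysis on root arcs and on signs.\<close>

lemma admissible_flip:
  assumes "k > 0" "admissible k W E s t p q b w"
  shows "admissible k W E s t q p (\<lambda>v. - b v) w"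
proof -
  have d: "deg E s t q p A = deg E s t p q A" for A by (simp add: deg_def)
  have "- (sum b W + sum p W - sum q W) = - sum b W + sum q W - sum p W" by linarith
  then have z: "2*k dvd - sum b W + sum q W - sum p W"
    using admissibleD(8)[OF assms(2)] by (metis dvd_minus_iff)
  note I = admissibleD[OF assms(2)]
  have b: "mod_dist k (sum (\<lambda>v. - b v) A) = mod_dist k (sum b A)" for A
    by (simp add: sum_negf mod_dist_uminus[OF assms(1)])
  have e: "even (deg E s t p q A - sum (\<lambda>v. - b v) A)" if "A \<subseteq> W" for A
    using I(7)[OF that] by (simp add: sum_negf)
  show ?thesis unfolding admissible_def d b
  proof (intro conjI allI impI ballI)
    show "2*k dvd sum (\<lambda>v. - b v) W + sum q W - sum p W" using z by (simp only: sum_negf)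
    show "sum q W + sum p W \<le> 2*k - 2 + mod_dist k (sum b W)" using I(9) by linarith
    fix A assume "A \<noteq> {}" "A \<subset> W" "\<not> (A = {w} \<and> 2*k dvd - b w)"
    then show "2*k - 2 + mod_dist k (sum b A) \<le> deg E s t p q A" by (intro I(10)) simp_all
  qed (fact I | rule I e, assumption)+
qed

lemma solvable_flip:
  assumes "solvable k W E s t q p (\<lambda>v. - b v)"
  shows "solvable k W E s t p q b"
proof -
  obtain \<epsilon> where \<epsilon>: "\<forall>e\<in>E. \<epsilon> e = 1 \<or> \<epsilon> e = -1"
    "\<forall>v\<in>W. 2*k dvd net E s t \<epsilon> v - (- b v + q v - p v)"
    using assms unfolding solvable_def by auto
  have n: "net E s t (\<lambda>e. - \<epsilon> e) v = - net E s t \<epsilon> v" for v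
    by (simp add: net_def sum_negf)
  have "2*k dvd net E s t (\<lambda>e. - \<epsilon> e) v - (b v + p v - q v)" if "v \<in> W" for v
  proof -
    have eq: "net E s t (\<lambda>e. - \<epsilon> e) v - (b v + p v - q v) = - (net E s t \<epsilon> v - (- b v + q v - p v))"
      by (simp add: n)
    show ?thesis unfolding eq dvd_minus_iff using \<epsilon>(2) that by (rule bspec)
  qed
  moreover have "\<forall>e\<in>E. - \<epsilon> e = 1 \<or> - \<epsilon> e = -1" using \<epsilon>(1) by force
  ultimately show ?thesis unfolding solvable_def by (intro exI[of _ "\<lambda>e. - \<epsilon> e"]) blast
qed

section \<open>Contraction of vertex sets\<close>

definition contr :: "'v set \<Rightarrow> ('v \<Rightarrow> 'v) \<Rightarrow> ('v \<Rightarrow> int) \<Rightarrow> 'v \<Rightarrow> int" where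
  "contr W \<phi> f u = sum f {v\<in>W. \<phi> v = u}"

lemma sum_contr:
  assumes "finite W" "finite B" shows "sum (contr W \<phi> f) B = sum f (W \<inter> \<phi> -` B)"
proof -
  have "sum (contr W \<phi> f) B = sum f (\<Union>u\<in>B. {v\<in>W. \<phi> v = u})"
    unfolding contr_def using assms by (subst sum.UNION_disjoint) auto
  also have "(\<Union>u\<in>B. {v\<in>W. \<phi> v = u}) = W \<inter> \<phi> -` B" by auto
  finally show ?thesis .
qed

lemma cut_contr:
  assumes "\<And>e. e \<in> E \<Longrightarrow> s e \<in> W \<and> t e \<in> W"
  shows "cut E (\<phi> \<circ> s) (\<phi> \<circ> t) B = cut E s t (W \<inter> \<phi> -` B)"
  unfolding cut_def using assms by (intro sum.cong) auto

text \<open>A contraction is an arbitrary vertex map composed with the end maps, so edges keep their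
  identity and an orientation of the contracted instance is one of the original. A set of new
  vertices has the degree and boundary of its preimage, hence inherits the cut condition.\<close>

lemma admissible_contr:
  assumes "admissible k W E s t p q b w"
  shows "admissible k (\<phi> ` W) E (\<phi> \<circ> s) (\<phi> \<circ> t) (contr W \<phi> p) (contr W \<phi> q) (contr W \<phi> b) (\<phi> w)"
proof -
  note I = admissibleD[OF assms]
  let ?P = "\<lambda>B. W \<inter> \<phi> -` B"
  have fin: "finite B" if "B \<subseteq> \<phi> ` W" for B using that I(1) finite_subset by blast
  have d: "deg E (\<phi> \<circ> s) (\<phi> \<circ> t) (contr W \<phi> p) (contr W \<phi> q) B = deg E s t p q (?P B)"
    if "B \<subseteq> \<phi> ` W" for B
    using cut_contr[of E s W t \<phi> B] I(3,4) by (simp add: deg_def sum_contr[OF I(1) fin[OF that]])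
  have sW: "sum (contr W \<phi> f) (\<phi> ` W) = sum f W" for f
    by (subst sum_contr) (use I(1) in \<open>auto intro!: sum.cong\<close>)
  have ineq: "2*k - 2 + mod_dist k (sum (contr W \<phi> b) B) \<le> deg E s t p q (?P B)"
    if B: "B \<noteq> {}" "B \<subset> \<phi> ` W" "\<not> (B = {\<phi> w} \<and> 2*k dvd contr W \<phi> b (\<phi> w))" for B
  proof -
    have P: "?P B \<noteq> {}" "?P B \<subset> W" using B by auto
    \<comment> \<open>If the preimage were the exempt singleton, \<open>B\<close> would be the
      singleton of its image with the same boundary, and so exempt itself.\<close>
    have "\<not> (?P B = {w} \<and> 2*k dvd b w)"
    proof
      assume *: "?P B = {w} \<and> 2*k dvd b w"
      have "B = \<phi> ` ?P B" using B by auto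
      then have "B = {\<phi> w}" using * by simp
      moreover have "contr W \<phi> b (\<phi> w) = sum (contr W \<phi> b) {\<phi> w}" by simp
      then have "contr W \<phi> b (\<phi> w) = b w"
        using * \<open>B = {\<phi> w}\<close> by (simp only: sum_contr[OF I(1) finite.emptyI[THEN finite.insertI]]) simp
      ultimately show False using B * by simp
    qed
    from I(10)[OF P this] show ?thesis using sum_contr[OF I(1) fin] B by auto
  qed
  show ?thesis unfolding admissible_def sW
  proof (intro conjI allI impI ballI)
    fix B assume "B \<subseteq> \<phi> ` W"
    then show "even (deg E (\<phi> \<circ> s) (\<phi> \<circ> t) (contr W \<phi> p) (contr W \<phi> q) B - sum (contr W \<phi> b) B)"
      using d sum_contr[OF I(1) fin] I(7)[of "?P B"] by auto
  next
    fix B assume "B \<noteq> {}" "B \<subset> \<phi> ` W" "\<not> (B = {\<phi> w} \<and> 2*k dvd contr W \<phi> b (\<phi> w))"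
    from ineq[OF this] d[of B] \<open>B \<subset> \<phi> ` W\<close>
    show "2*k - 2 + mod_dist k (sum (contr W \<phi> b) B) \<le> deg E (\<phi> \<circ> s) (\<phi> \<circ> t) (contr W \<phi> p) (contr W \<phi> q) B"
      by auto
  next
    show "2*k dvd sum b W + sum p W - sum q W" by (fact I(8))
    show "sum p W + sum q W \<le> 2*k - 2 + mod_dist k (sum b W)" by (fact I(9))
    show "0 \<le> contr W \<phi> p u" "0 \<le> contr W \<phi> q u" for u
      using I(5,6) by (auto simp: contr_def intro: sum_nonneg)
  qed (use I(1-4) in simp_all)
qed

lemma net_contr:
  assumes "finite W" "\<And>e. e \<in> E \<Longrightarrow> s e \<in> W \<and> t e \<in> W"
  shows "net E (\<phi> \<circ> s) (\<phi> \<circ> t) \<epsilon> u = sum (net E s t \<epsilon>) {v\<in>W. \<phi> v = u}"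
proof -
  have "sum (net E s t \<epsilon>) {v\<in>W. \<phi> v = u}
     = (\<Sum>e\<in>E. \<epsilon> e * (of_bool (s e \<in> {v\<in>W. \<phi> v = u}) - of_bool (t e \<in> {v\<in>W. \<phi> v = u})))"
    using assms(1) by (intro sum_net) auto
  also have "\<dots> = net E (\<phi> \<circ> s) (\<phi> \<circ> t) \<epsilon> u"
    unfolding net_def using assms(2) by (intro sum.cong) auto
  finally show ?thesis by simp
qed

lemma net_cong_at:
  assumes "\<And>e. e \<in> E \<Longrightarrow> s e = v \<or> t e = v \<Longrightarrow> s e \<noteq> t e \<Longrightarrow> \<epsilon> e = \<epsilon>' e"
  shows "net E s t \<epsilon> v = net E s t \<epsilon>' v"
  unfolding net_def
proof (rule sum.cong)
  fix e assume "e \<in> E"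
  then show "\<epsilon> e * (of_bool (s e = v) - of_bool (t e = v)) = \<epsilon>' e * (of_bool (s e = v) - of_bool (t e = v))"
    using assms[of e] by (cases "s e = v"; cases "t e = v") auto
qed simp

text \<open>
  Solve the instance with \<open>A\<close> contracted first. Its solution orients the edges leaving \<open>A\<close>, which
  become root arcs of the instance on \<open>A\<close>; tightness is the root condition there.
\<close>

lemma solvable_tight:
  fixes W :: "'v set" and E :: "'e set"
  assumes adm: "admissible k W E s t p q b w"
    and A: "A \<subset> W" "2 \<le> card A"
    and tight: "deg E s t p q A \<le> 2*k - 2 + mod_dist k (sum b A)"
    and IH: "\<And>(W' :: 'v set) (E' :: 'e set) s' t' p' q' b' w'. card W' < card W \<Longrightarrow>
        admissible k W' E' s' t' p' q' b' w' \<Longrightarrow> solvable k W' E' s' t' p' q' b'"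
  shows "solvable k W E s t p q b"
proof -
  note I = admissibleD[OF adm]
  have finA: "finite A" using A I(1) finite_subset by blast
  obtain a where a: "a \<in> A" using A(2) by fastforce
  \<comment> \<open>A vertex of \<open>A\<close> represents the contracted set, so the vertex type
    stays the same for the induction hypothesis.\<close>
  define \<phi> where "\<phi> v = (if v \<in> A then a else v)" for v
  have "\<phi> ` W \<subseteq> W - (A - {a})" using A a by (auto simp: \<phi>_def)
  then have "card (\<phi> ` W) \<le> card (W - (A - {a}))" using I(1) by (intro card_mono) auto
  also have "\<dots> < card W"
  proof (rule psubset_card_mono[OF I(1)])
    have "card (A - {a}) \<ge> 1" using A(2) a finA by simp
    then have "A - {a} \<noteq> {}" by (metis card.empty not_one_le_zero)
    then show "W - (A - {a}) \<subset> W" using A by blast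
  qed
  finally have "card (\<phi> ` W) < card W" .
  from IH[OF this admissible_contr[OF adm]] obtain \<epsilon>1 where
    \<epsilon>1: "\<And>e. e \<in> E \<Longrightarrow> \<epsilon>1 e = 1 \<or> \<epsilon>1 e = -1" and
    net1: "\<And>u. u \<in> \<phi> ` W \<Longrightarrow> 2*k dvd net E (\<phi> \<circ> s) (\<phi> \<circ> t) \<epsilon>1 u -
      (contr W \<phi> b u + contr W \<phi> p u - contr W \<phi> q u)"
    unfolding solvable_def by auto
  have netc: "net E (\<phi> \<circ> s) (\<phi> \<circ> t) \<epsilon>1 u = sum (net E s t \<epsilon>1) {v\<in>W. \<phi> v = u}" for u
    using I(1,3,4) by (intro net_contr) auto
  have out: "2*k dvd net E s t \<epsilon>1 u - (b u + p u - q u)" if "u \<in> W - A" for u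
  proof -
    have "{v\<in>W. \<phi> v = u} = {u}" using that a by (auto simp: \<phi>_def)
    moreover have "u \<in> \<phi> ` W" using that by (auto simp: \<phi>_def image_iff)
    ultimately show ?thesis using net1[of u] by (simp add: netc contr_def)
  qed
  have inA: "2*k dvd sum (net E s t \<epsilon>1) A - (sum b A + sum p A - sum q A)"
  proof -
    have "{v\<in>W. \<phi> v = a} = A" using A a by (auto simp: \<phi>_def)
    moreover have "a \<in> \<phi> ` W" using a A by (auto simp: \<phi>_def image_iff)
    ultimately show ?thesis using net1[of a] by (simp add: netc contr_def)
  qed
  define X where "X = {e\<in>E. (s e \<in> A) \<noteq> (t e \<in> A)}"
  define Y where "Y = {e\<in>E. s e \<notin> A \<and> t e \<notin> A}"
  define F where "F = {e\<in>E. s e \<in> A \<and> t e \<in> A}"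
  have fin: "finite X" "finite Y" "finite F" using I(2) by (auto simp: X_def Y_def F_def)
  have split: "sum g E = sum g F + sum g X + sum g Y" for g :: "'e \<Rightarrow> int"
  proof -
    have "E = F \<union> X \<union> Y" by (auto simp: X_def Y_def F_def)
    moreover have "sum g (F \<union> X \<union> Y) = sum g (F \<union> X) + sum g Y"
      using fin by (intro sum.union_disjoint) (auto simp: X_def Y_def F_def)
    moreover have "sum g (F \<union> X) = sum g F + sum g X"
      using fin by (intro sum.union_disjoint) (auto simp: X_def Y_def F_def)
    ultimately show ?thesis by simp
  qed
  \<comment> \<open>The contribution of the already oriented edge \<open>e\<close> to the boundary
    at \<open>v\<close>. In the instance on \<open>A\<close> the value -1 makes \<open>e\<close> an
    arc from the root to \<open>v\<close>, the value 1 an arc from \<open>v\<close> to the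
    root.\<close>
  define c where "c e v = \<epsilon>1 e * (of_bool (s e = v) - of_bool (t e = v))" for e v
  define p' where "p' v = p v + (\<Sum>e\<in>X. of_bool (c e v = -1))" for v
  define q' where "q' v = q v + (\<Sum>e\<in>X. of_bool (c e v = 1))" for v
  have cX: "of_bool (c e v = -1) + of_bool (c e v = 1) = (of_bool (s e = v) + of_bool (t e = v) :: int)"
    "of_bool (c e v = -1) - of_bool (c e v = 1) = - c e v" if "e \<in> X" for e v
    using \<epsilon>1[of e] that by (auto simp: c_def X_def of_bool_def split: if_splits)
  have diff: "p' v - q' v = p v - q v - (\<Sum>e\<in>X. c e v)" for v
  proof -
    have "p' v - q' v = p v - q v + (\<Sum>e\<in>X. of_bool (c e v = -1) - of_bool (c e v = 1))"
      unfolding p'_def q'_def by (simp add: sum_subtractf)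
    also have "(\<Sum>e\<in>X. of_bool (c e v = -1) - of_bool (c e v = 1)) = (\<Sum>e\<in>X. - c e v)"
      by (rule sum.cong[OF refl]) (rule cX(2))
    finally show ?thesis by (simp add: sum_negf)
  qed
  have deg': "deg F s t p' q' B = deg E s t p q B" if "B \<subseteq> A" for B
  proof -
    have finB: "finite B" using that finA finite_subset by blast
    have "sum p' B + sum q' B = sum p B + sum q B + (\<Sum>v\<in>B. \<Sum>e\<in>X. of_bool (c e v = -1) + of_bool (c e v = 1))"
      unfolding p'_def q'_def by (simp add: sum.distrib)
    also have "(\<Sum>v\<in>B. \<Sum>e\<in>X. of_bool (c e v = -1) + of_bool (c e v = 1)) =
       (\<Sum>v\<in>B. \<Sum>e\<in>X. of_bool (s e = v) + of_bool (t e = v) :: int)"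
      by (intro sum.cong refl) (rule cX(1))
    also have "\<dots> = (\<Sum>e\<in>X. \<Sum>v\<in>B. of_bool (s e = v) + of_bool (t e = v) :: int)"
      by (rule sum.swap)
    also have "\<dots> = (\<Sum>e\<in>X. of_bool (s e \<in> B) + of_bool (t e \<in> B))"
      by (simp add: sum.distrib sum_of_bool_eq[OF finB])
    also have "\<dots> = (\<Sum>e\<in>X. of_bool ((s e \<in> B) \<noteq> (t e \<in> B)))"
      using that by (intro sum.cong) (auto simp: X_def)
    finally have 1: "sum p' B + sum q' B = sum p B + sum q B + (\<Sum>e\<in>X. of_bool ((s e \<in> B) \<noteq> (t e \<in> B)))" .
    have "(\<Sum>e\<in>Y. of_bool ((s e \<in> B) \<noteq> (t e \<in> B)) :: int) = 0"
      using that by (intro sum.neutral) (auto simp: Y_def)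
    then have "cut E s t B = cut F s t B + (\<Sum>e\<in>X. of_bool ((s e \<in> B) \<noteq> (t e \<in> B)))"
      unfolding cut_def by (subst split) simp
    with 1 show ?thesis by (simp add: deg_def)
  qed
  have netA: "sum (net E s t \<epsilon>1) A = (\<Sum>v\<in>A. \<Sum>e\<in>X. c e v)"
  proof -
    have "sum (net E s t \<epsilon>1) A = (\<Sum>e\<in>E. \<epsilon>1 e * (of_bool (s e \<in> A) - of_bool (t e \<in> A)))"
      using finA by (rule sum_net)
    also have "\<dots> = (\<Sum>e\<in>X. \<epsilon>1 e * (of_bool (s e \<in> A) - of_bool (t e \<in> A)))"
      using I(2) by (intro sum.mono_neutral_right) (auto simp: X_def)
    also have "\<dots> = sum (net X s t \<epsilon>1) A" using finA by (rule sum_net[symmetric])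
    finally show ?thesis by (simp add: net_def c_def)
  qed
  have "admissible k A F s t p' q' b w"
    unfolding admissible_def
  proof (intro conjI ballI allI impI)
    fix v assume v: "v \<in> A"
    show "0 \<le> p' v" "0 \<le> q' v" using I(5,6)[of v] v A by (auto simp: p'_def q'_def intro!: add_nonneg_nonneg sum_nonneg)
  next
    fix B assume B: "B \<subseteq> A"
    show "even (deg F s t p' q' B - sum b B)" unfolding deg'[OF B] using B A by (intro I(7)) auto
  next
    \<comment> \<open>The divisibility condition at the root of the inner instance is, up to sign,
      the congruence solved at the contracted vertex.\<close>
    have "sum b A + sum p' A - sum q' A = sum b A + (\<Sum>v\<in>A. p' v - q' v)"
      by (simp add: sum_subtractf)
    also have "\<dots> = - (sum (net E s t \<epsilon>1) A - (sum b A + sum p A - sum q A))"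
      by (simp add: diff sum_subtractf netA)
    finally have eq: "sum b A + sum p' A - sum q' A = \<dots>" .
    show "2*k dvd sum b A + sum p' A - sum q' A" unfolding eq dvd_minus_iff by (rule inA)
  next
    have "cut F s t A = 0" unfolding cut_def by (intro sum.neutral) (auto simp: F_def)
    then have "sum p' A + sum q' A = deg F s t p' q' A" by (simp add: deg_def)
    then show "sum p' A + sum q' A \<le> 2*k - 2 + mod_dist k (sum b A)" using tight deg'[of A] by simp
  next
    fix B assume B: "B \<noteq> {}" "B \<subset> A" "\<not> (B = {w} \<and> 2*k dvd b w)"
    then have "deg F s t p' q' B = deg E s t p q B" by (intro deg') auto
    moreover have "B \<subset> W" using B A by blast
    ultimately show "2*k - 2 + mod_dist k (sum b B) \<le> deg F s t p' q' B" using I(10)[OF B(1) _ B(3)] by simp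
  qed (use finA fin in \<open>auto simp: F_def\<close>)
  from IH[OF psubset_card_mono[OF I(1) A(1)] this] obtain \<epsilon>2 where
    \<epsilon>2: "\<And>e. e \<in> F \<Longrightarrow> \<epsilon>2 e = 1 \<or> \<epsilon>2 e = -1" and
    net2: "\<And>u. u \<in> A \<Longrightarrow> 2*k dvd net F s t \<epsilon>2 u - (b u + p' u - q' u)"
    unfolding solvable_def by auto
  define \<epsilon> where "\<epsilon> e = (if e \<in> F then \<epsilon>2 e else \<epsilon>1 e)" for e
  have "2*k dvd net E s t \<epsilon> v - (b v + p v - q v)" if "v \<in> W" for v
  proof (cases "v \<in> A")
    case True
    have "net E s t \<epsilon> v = net F s t \<epsilon> v + net X s t \<epsilon> v + net Y s t \<epsilon> v"
      unfolding net_def by (rule split)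
    moreover have "net Y s t \<epsilon> v = 0" unfolding net_def
      using True by (intro sum.neutral) (auto simp: Y_def)
    moreover have "net F s t \<epsilon> v = net F s t \<epsilon>2 v" by (rule net_cong) (simp add: \<epsilon>_def)
    moreover have "net X s t \<epsilon> v = net X s t \<epsilon>1 v" by (rule net_cong) (auto simp: \<epsilon>_def X_def F_def)
    moreover have "net X s t \<epsilon>1 v = (\<Sum>e\<in>X. c e v)" by (simp add: net_def c_def)
    ultimately have eq: "net E s t \<epsilon> v - (b v + p v - q v) = net F s t \<epsilon>2 v - (b v + p' v - q' v)"
      using diff[of v] by simp
    show ?thesis unfolding eq by (rule net2[OF True])
  next
    case False
    have "net E s t \<epsilon> v = net E s t \<epsilon>1 v" using False by (intro net_cong_at) (auto simp: \<epsilon>_def F_def)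
    then show ?thesis using out[of v] that False by simp
  qed
  moreover have "\<forall>e\<in>E. \<epsilon> e = 1 \<or> \<epsilon> e = -1" using \<epsilon>1 \<epsilon>2 by (simp add: \<epsilon>_def)
  ultimately show ?thesis unfolding solvable_def by (intro exI[of _ \<epsilon>]) simp
qed

text \<open>If \<open>y\<close> is the only neighbour of \<open>v\<close>, identify the two and
  solve. The edges between them have become loops, so they can be reoriented freely:
  \<open>j\<close> of them leaving \<open>v\<close> give \<open>v\<close> its boundary, and
  \<open>y\<close> follows because the sum over both vertices does not change.\<close>

lemma solvable_merge:
  fixes W :: "'v set" and E :: "'e set"
  assumes adm: "admissible k W E s t p q b w"
    and vy: "v \<in> W" "y \<in> W" "v \<noteq> y" and zero: "p v = 0" "q v = 0"
    and nbr: "\<And>e. e \<in> E \<Longrightarrow> s e = v \<Longrightarrow> t e \<in> {v, y}" "\<And>e. e \<in> E \<Longrightarrow> t e = v \<Longrightarrow> s e \<in> {v, y}"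
    and j: "0 \<le> j" "j \<le> deg E s t p q {v}" "2*k dvd (2*j - deg E s t p q {v}) - b v"
    and IH: "\<And>(W' :: 'v set) (E' :: 'e set) s' t' p' q' b' w'. card W' < card W \<Longrightarrow>
        admissible k W' E' s' t' p' q' b' w' \<Longrightarrow> solvable k W' E' s' t' p' q' b'"
  shows "solvable k W E s t p q b"
proof -
  note I = admissibleD[OF adm]
  define \<phi> where "\<phi> u = (if u = v then y else u)" for u
  have "\<phi> ` W \<subset> W" using vy by (auto simp: \<phi>_def)
  then have "card (\<phi> ` W) < card W" using I(1) by (rule psubset_card_mono[rotated])
  from IH[OF this admissible_contr[OF adm]] obtain \<epsilon>1 where
    \<epsilon>1: "\<And>e. e \<in> E \<Longrightarrow> \<epsilon>1 e = 1 \<or> \<epsilon>1 e = -1" and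
    net1: "\<And>u. u \<in> \<phi> ` W \<Longrightarrow> 2*k dvd net E (\<phi> \<circ> s) (\<phi> \<circ> t) \<epsilon>1 u -
      (contr W \<phi> b u + contr W \<phi> p u - contr W \<phi> q u)"
    unfolding solvable_def by auto
  have netc: "net E (\<phi> \<circ> s) (\<phi> \<circ> t) \<epsilon>1 u = sum (net E s t \<epsilon>1) {v\<in>W. \<phi> v = u}" for u
    using I(1,3,4) by (intro net_contr) auto
  have out: "2*k dvd net E s t \<epsilon>1 u - (b u + p u - q u)" if "u \<in> W - {v, y}" for u
  proof -
    have "{v\<in>W. \<phi> v = u} = {u}" using that by (auto simp: \<phi>_def)
    moreover have "u \<in> \<phi> ` W" using that by (auto simp: \<phi>_def image_iff)
    ultimately show ?thesis using net1[of u] by (simp add: netc contr_def)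
  qed
  have atvy: "2*k dvd sum (net E s t \<epsilon>1) {v, y} - (b v + (b y + p y - q y))"
  proof -
    have "{u\<in>W. \<phi> u = y} = {v, y}" using vy by (auto simp: \<phi>_def)
    moreover have "y \<in> \<phi> ` W" using vy by (auto simp: \<phi>_def image_iff)
    ultimately show ?thesis using net1[of y] vy zero by (simp add: netc contr_def algebra_simps)
  qed
  define L where "L = {e\<in>E. (s e = v) \<noteq> (t e = v)}"
  have finL: "finite L" using I(2) by (simp add: L_def)
  have n: "deg E s t p q {v} = int (card L)"
  proof -
    have "cut E s t {v} = (\<Sum>e\<in>L. 1)" unfolding cut_def L_def
      using I(2) by (intro sum.mono_neutral_cong_right) auto
    then show ?thesis by (simp add: deg_def zero)
  qed
  have "nat j \<le> card L" using j n by linarith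
  then obtain S where S: "S \<subseteq> L" "card S = nat j" by (rule obtain_subset_with_card_n)
  \<comment> \<open>\<open>S\<close> is the set of edges that are to leave \<open>v\<close>; the
    sign depends on which end is named by \<open>s\<close>.\<close>
  define \<epsilon> where "\<epsilon> e = (if e \<in> L then (if (e \<in> S) = (s e = v) then 1 else -1) else \<epsilon>1 e)" for e
  have netv: "net E s t \<epsilon> v = 2*j - deg E s t p q {v}"
  proof -
    have "net E s t \<epsilon> v = (\<Sum>e\<in>L. if e \<in> S then 1 else -1)" unfolding net_def
      using I(2) by (intro sum.mono_neutral_cong_right) (auto simp: L_def \<epsilon>_def)
    also have "\<dots> = (\<Sum>e\<in>L. 2 * of_bool (e \<in> S) - 1)" by (intro sum.cong) auto
    also have "\<dots> = 2 * (\<Sum>e\<in>L. of_bool (e \<in> S)) - int (card L)"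
      by (simp add: sum_subtractf sum_distrib_left)
    also have "(\<Sum>e\<in>L. of_bool (e \<in> S)) = int (card (L \<inter> S))"
      using finL by (simp add: of_bool_def sum.If_cases Int_def)
    also have "L \<inter> S = S" using S by auto
    finally show ?thesis using S j n by simp
  qed
  have netvy: "sum (net E s t \<epsilon>) {v, y} = sum (net E s t \<epsilon>1) {v, y}"
  proof -
    have "s e \<in> {v, y} \<and> t e \<in> {v, y}" if "e \<in> L" for e using that nbr[of e] by (auto simp: L_def)
    then show ?thesis by (simp only: sum_net finite.intros) (intro sum.cong, auto simp: \<epsilon>_def)
  qed
  have "2*k dvd net E s t \<epsilon> u - (b u + p u - q u)" if u: "u \<in> W" for u
  proof -
    consider "u = v" | "u = y" | "u \<noteq> v" "u \<noteq> y" by blast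
    then show ?thesis
    proof cases
      case 1
      then show ?thesis using netv j(3) zero by simp
    next
      case 2
      have eq: "net E s t \<epsilon> y - (b y + p y - q y) =
        (sum (net E s t \<epsilon>1) {v, y} - (b v + (b y + p y - q y))) - ((2*j - deg E s t p q {v}) - b v)"
        using netvy netv vy by simp
      show ?thesis unfolding 2 eq by (rule dvd_diff[OF atvy j(3)])
    next
      case 3
      have "net E s t \<epsilon> u = net E s t \<epsilon>1 u"
        using 3 nbr by (intro net_cong_at) (auto simp: \<epsilon>_def L_def)
      then show ?thesis using out[of u] 3 u by simp
    qed
  qed
  moreover have "\<forall>e\<in>E. \<epsilon> e = 1 \<or> \<epsilon> e = -1" using \<epsilon>1 by (simp add: \<epsilon>_def)
  ultimately show ?thesis unfolding solvable_def by (intro exI[of _ \<epsilon>]) simp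
qed

section \<open>Splitting off a vertex of boundary 0\<close>

definition joins :: "('e \<Rightarrow> 'v) \<Rightarrow> ('e \<Rightarrow> 'v) \<Rightarrow> 'e \<Rightarrow> 'v \<Rightarrow> 'v \<Rightarrow> bool" where
  "joins s t e x y \<longleftrightarrow> s e = x \<and> t e = y \<or> s e = y \<and> t e = x"

text \<open>The edge is oriented from \<open>x\<close> to \<open>y\<close>. Only the combination
  \<open>b + p - q\<close> is constrained, so the compensation may be charged to the boundary, when
  an edge is deleted, or to root arcs, when one is moved.\<close>

lemma solvable_remove:
  assumes e: "finite E" "e \<in> E" "joins s t e x y"
    and sol: "solvable k W (E - {e}) s t p' q' b'"
    and r: "\<And>u. u \<in> W \<Longrightarrow> b' u + p' u - q' u = b u + p u - q u - of_bool (u = x) + of_bool (u = y)"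
  shows "solvable k W E s t p q b"
proof -
  obtain \<epsilon>' where \<epsilon>': "\<forall>f\<in>E-{e}. \<epsilon>' f = 1 \<or> \<epsilon>' f = -1"
    "\<And>v. v \<in> W \<Longrightarrow> 2*k dvd net (E - {e}) s t \<epsilon>' v - (b' v + p' v - q' v)"
    using sol unfolding solvable_def by auto
  define \<epsilon> where "\<epsilon> = \<epsilon>'(e := if s e = x then 1 else -1)"
  have "net E s t \<epsilon> u - (b u + p u - q u) = net (E - {e}) s t \<epsilon>' u - (b' u + p' u - q' u)"
    if "u \<in> W" for u
  proof -
    have "net (E - {e}) s t \<epsilon>' u = net (E - {e}) s t \<epsilon> u"
      by (rule net_cong) (auto simp: \<epsilon>_def)
    then show ?thesis using net_remove[OF e(1,2), of s t \<epsilon> u] r[OF that] e(3)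
      by (auto simp: \<epsilon>_def joins_def)
  qed
  then have "\<forall>v\<in>W. 2*k dvd net E s t \<epsilon> v - (b v + p v - q v)" using \<epsilon>'(2) by simp
  moreover have "\<forall>f\<in>E. \<epsilon> f = 1 \<or> \<epsilon> f = -1" using \<epsilon>'(1) by (simp add: \<epsilon>_def)
  ultimately show ?thesis unfolding solvable_def by (intro exI[of _ \<epsilon>]) simp
qed

text \<open>The lifted edge, which reuses the name \<open>e1\<close>, is subdivided again: an
  orientation from \<open>x\<close> to \<open>y\<close> becomes a path from \<open>x\<close> through
  \<open>v\<close> to \<open>y\<close>, with contribution 0 at \<open>v\<close>.\<close>

lemma solvable_unlift:
  assumes e: "finite E" "e1 \<in> E" "e2 \<in> E" "e1 \<noteq> e2" "joins s t e1 v x" "joins s t e2 v y"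
    and sol: "solvable k W (E - {e2}) (s(e1 := x)) (t(e1 := y)) p q b"
  shows "solvable k W E s t p q b"
proof -
  let ?s = "s(e1 := x)" and ?t = "t(e1 := y)"
  obtain \<epsilon>' where \<epsilon>': "\<forall>f\<in>E-{e2}. \<epsilon>' f = 1 \<or> \<epsilon>' f = -1"
    "\<And>v. v \<in> W \<Longrightarrow> 2*k dvd net (E - {e2}) ?s ?t \<epsilon>' v - (b v + p v - q v)"
    using sol unfolding solvable_def by auto
  define \<epsilon> where "\<epsilon> = \<epsilon>'(e1 := if s e1 = x then \<epsilon>' e1 else - \<epsilon>' e1, e2 := if s e2 = v then \<epsilon>' e1 else - \<epsilon>' e1)"
  have "net E s t \<epsilon> u = net (E - {e2}) ?s ?t \<epsilon>' u" for u
  proof -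
    have 1: "net (E - {e2} - {e1}) s t \<epsilon> u = net (E - {e2} - {e1}) ?s ?t \<epsilon>' u"
      by (rule net_cong) (auto simp: \<epsilon>_def)
    have 2: "net (E - {e2} - {e1}) s t \<epsilon> u = net E s t \<epsilon> u
        - \<epsilon> e2 * (of_bool (s e2 = u) - of_bool (t e2 = u)) - \<epsilon> e1 * (of_bool (s e1 = u) - of_bool (t e1 = u))"
      using e by (simp add: net_remove)
    have 3: "net (E - {e2} - {e1}) ?s ?t \<epsilon>' u = net (E - {e2}) ?s ?t \<epsilon>' u - \<epsilon>' e1 * (of_bool (x = u) - of_bool (y = u))"
      using e by (simp add: net_remove)
    have "\<epsilon> e2 * (of_bool (s e2 = u) - of_bool (t e2 = u)) = \<epsilon>' e1 * (of_bool (v = u) - of_bool (y = u))"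
      using e(6) by (auto simp: \<epsilon>_def joins_def)
    moreover have "\<epsilon> e1 * (of_bool (s e1 = u) - of_bool (t e1 = u)) = \<epsilon>' e1 * (of_bool (x = u) - of_bool (v = u))"
      using e(4,5) by (auto simp: \<epsilon>_def joins_def)
    ultimately show ?thesis using 1 2 3 by (simp add: algebra_simps)
  qed
  then have "\<forall>v\<in>W. 2*k dvd net E s t \<epsilon> v - (b v + p v - q v)" using \<epsilon>'(2) by simp
  moreover have "\<forall>f\<in>E. \<epsilon> f = 1 \<or> \<epsilon> f = -1" using \<epsilon>'(1) e(2,4) by (auto simp: \<epsilon>_def)
  ultimately show ?thesis unfolding solvable_def by (intro exI[of _ \<epsilon>]) simp
qed

text \<open>A lifting costs a set at most 2. The vertex \<open>v\<close> is exempt, the other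
  singletons lose nothing, and larger proper subsets have the surplus.\<close>

lemma admissible_lift:
  assumes adm: "admissible k W E s t p q b v" and v: "v \<in> W"
    and exempt: "2*k dvd b v"
    and slack: "\<And>A. A \<subset> W \<Longrightarrow> 2 \<le> card A \<Longrightarrow> 2*k + mod_dist k (sum b A) \<le> deg E s t p q A"
    and E': "E' \<subseteq> E" "\<And>e. e \<in> E' \<Longrightarrow> s' e \<in> W \<and> t' e \<in> W"
    and pq: "\<And>u. u \<in> W \<Longrightarrow> 0 \<le> p' u \<and> 0 \<le> q' u" "sum p' W = sum p W" "sum q' W = sum q W"
    and deg': "\<And>A. A \<subseteq> W \<Longrightarrow> deg E' s' t' p' q' A = deg E s t p q A \<or> deg E' s' t' p' q' A = deg E s t p q A - 2"
    and deg1: "\<And>u. u \<in> W \<Longrightarrow> u \<noteq> v \<Longrightarrow> deg E' s' t' p' q' {u} = deg E s t p q {u}"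
  shows "admissible k W E' s' t' p' q' b v"
proof -
  note I = admissibleD[OF adm]
  show ?thesis unfolding admissible_def
  proof (intro conjI ballI allI impI)
    fix A assume "A \<subseteq> W"
    then show "even (deg E' s' t' p' q' A - sum b A)" using deg'[of A] I(7)[of A] by auto
  next
    show "2*k dvd sum b W + sum p' W - sum q' W" unfolding pq by (fact I(8))
    show "sum p' W + sum q' W \<le> 2*k - 2 + mod_dist k (sum b W)" unfolding pq by (fact I(9))
  next
    fix A assume A: "A \<noteq> {}" "A \<subset> W" "\<not> (A = {v} \<and> 2*k dvd b v)"
    have "finite A" using A(2) I(1) finite_subset by blast
    then have "card A \<noteq> 0" using A(1) by simp
    then consider "A = {v}" | u where "A = {u}" "u \<noteq> v" | "2 \<le> card A"
      by (metis One_nat_def card_1_singletonE less_2_cases not_less)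
    then show "2*k - 2 + mod_dist k (sum b A) \<le> deg E' s' t' p' q' A"
    proof cases
      case 1
      then show ?thesis using A exempt by auto
    next
      case 2
      then show ?thesis using deg1[of u] A I(10)[OF A] by auto
    next
      case 3
      then show ?thesis using slack[OF A(2)] deg'[of A] A(2) by fastforce
    qed
  qed (use I(1,2) finite_subset[OF E'(1)] E' pq in auto)
qed

text \<open>Only sets separating \<open>v\<close> from both \<open>x\<close> and \<open>y\<close>
  lose degree. As \<open>x\<close> and \<open>y\<close> differ, \<open>{v}\<close> is the only such
  singleton.\<close>

lemma solvable_lift_edges:
  fixes W :: "'v set" and E :: "'e set"
  assumes adm: "admissible k W E s t p q b v" and v: "v \<in> W"
    and exempt: "2*k dvd b v"
    and slack: "\<And>A. A \<subset> W \<Longrightarrow> 2 \<le> card A \<Longrightarrow> 2*k + mod_dist k (sum b A) \<le> deg E s t p q A"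
    and e: "e1 \<in> E" "e2 \<in> E" "joins s t e1 v x" "joins s t e2 v y" "x \<noteq> y" "x \<noteq> v" "y \<noteq> v"
    and IH: "\<And>(E' :: 'e set) s' t' p' q'. card E' < card E \<Longrightarrow>
        admissible k W E' s' t' p' q' b v \<Longrightarrow> solvable k W E' s' t' p' q' b"
  shows "solvable k W E s t p q b"
proof -
  note I = admissibleD[OF adm]
  let ?s = "s(e1 := x)" and ?t = "t(e1 := y)"
  have ne: "e1 \<noteq> e2" using e by (auto simp: joins_def)
  have W: "x \<in> W" "y \<in> W" using I(3,4) e by (auto simp: joins_def)
  have d: "deg (E - {e2}) ?s ?t p q A = deg E s t p q A - 2 * of_bool ((v \<in> A) \<noteq> (x \<in> A) \<and> (v \<in> A) \<noteq> (y \<in> A))" for A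
  proof -
    have 1: "cut (E - {e2} - {e1}) s t A = cut (E - {e2} - {e1}) ?s ?t A"
      by (rule cut_cong) auto
    have 2: "cut (E - {e2} - {e1}) s t A = cut E s t A
        - of_bool ((s e2 \<in> A) \<noteq> (t e2 \<in> A)) - of_bool ((s e1 \<in> A) \<noteq> (t e1 \<in> A))"
      using e ne I(2) by (simp add: cut_remove)
    have 3: "cut (E - {e2} - {e1}) ?s ?t A = cut (E - {e2}) ?s ?t A - of_bool ((x \<in> A) \<noteq> (y \<in> A))"
      using e ne I(2) by (simp add: cut_remove)
    have "(of_bool ((s e2 \<in> A) \<noteq> (t e2 \<in> A)) :: int) = of_bool ((v \<in> A) \<noteq> (y \<in> A))"
      "(of_bool ((s e1 \<in> A) \<noteq> (t e1 \<in> A)) :: int) = of_bool ((v \<in> A) \<noteq> (x \<in> A))"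
      using e(3,4) by (auto simp: joins_def)
    then have "cut (E - {e2}) ?s ?t A = cut E s t A
        - of_bool ((v \<in> A) \<noteq> (y \<in> A)) - of_bool ((v \<in> A) \<noteq> (x \<in> A)) + of_bool ((x \<in> A) \<noteq> (y \<in> A))"
      using 1 2 3 by linarith
    then show ?thesis unfolding deg_def by (cases "v \<in> A"; cases "x \<in> A"; cases "y \<in> A") auto
  qed
  have "admissible k W (E - {e2}) ?s ?t p q b v"
  proof (rule admissible_lift[OF adm v exempt slack])
    fix u assume "u \<noteq> v"
    then show "deg (E - {e2}) ?s ?t p q {u} = deg E s t p q {u}" using e by (auto simp: d)
  qed (use W I in \<open>auto simp: d\<close>)
  moreover have "card (E - {e2}) < card E" using e I(2) by (intro card_Diff1_less) auto
  ultimately have "solvable k W (E - {e2}) ?s ?t p q b" by (intro IH)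
  then show ?thesis using I(2) e ne by (intro solvable_unlift[of E e1 e2 s t v x y]) auto
qed

text \<open>Here the lifted pair is an arc from the root to \<open>v\<close> followed by
  \<open>e\<close>; it is replaced by an arc from the root to \<open>y\<close>, which forces
  \<open>e\<close> to be oriented from \<open>v\<close> to \<open>y\<close>.\<close>

lemma solvable_lift_root:
  fixes W :: "'v set" and E :: "'e set"
  assumes adm: "admissible k W E s t p q b v" and v: "v \<in> W"
    and exempt: "2*k dvd b v"
    and slack: "\<And>A. A \<subset> W \<Longrightarrow> 2 \<le> card A \<Longrightarrow> 2*k + mod_dist k (sum b A) \<le> deg E s t p q A"
    and e: "e \<in> E" "joins s t e v y" "y \<noteq> v" "0 < p v"
    and IH: "\<And>(E' :: 'e set) s' t' p' q'. card E' < card E \<Longrightarrow>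
        admissible k W E' s' t' p' q' b v \<Longrightarrow> solvable k W E' s' t' p' q' b"
  shows "solvable k W E s t p q b"
proof -
  note I = admissibleD[OF adm]
  let ?p = "p(v := p v - 1, y := p y + 1)"
  have y: "y \<in> W" using I(3,4) e by (auto simp: joins_def)
  have p: "sum ?p A = sum p A - of_bool (v \<in> A) + of_bool (y \<in> A)" if "finite A" for A
    using e(3) by (simp only: sum_upd[OF that]) simp
  have d: "deg (E - {e}) s t ?p q A = deg E s t p q A - 2 * of_bool (v \<in> A \<and> y \<notin> A)" if "A \<subseteq> W" for A
  proof -
    have fin: "finite A" using that I(1) finite_subset by blast
    have "(of_bool ((s e \<in> A) \<noteq> (t e \<in> A)) :: int) = of_bool ((v \<in> A) \<noteq> (y \<in> A))"
      using e(2) by (auto simp: joins_def)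
    then show ?thesis unfolding deg_def p[OF fin] cut_remove[OF I(2) e(1)]
      by (cases "v \<in> A"; cases "y \<in> A") simp_all
  qed
  have "admissible k W (E - {e}) s t ?p q b v"
  proof (rule admissible_lift[OF adm v exempt slack])
    fix u assume "u \<in> W" "u \<noteq> v"
    then show "deg (E - {e}) s t ?p q {u} = deg E s t p q {u}" using e by (subst d) auto
  next
    show "sum ?p W = sum p W" using v y by (simp only: p[OF I(1)] of_bool_eq)
  next
    fix A assume "A \<subseteq> W"
    then show "deg (E - {e}) s t ?p q A = deg E s t p q A \<or> deg (E - {e}) s t ?p q A = deg E s t p q A - 2"
      by (simp add: d)
  next
    fix u assume "u \<in> W"
    then show "0 \<le> ?p u \<and> 0 \<le> q u" using I(5)[of u] I(5)[OF y] I(6)[of u] e(4) by auto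
  qed (use I in auto)
  moreover have "card (E - {e}) < card E" using e I(2) by (intro card_Diff1_less) auto
  ultimately have "solvable k W (E - {e}) s t ?p q b" by (intro IH)
  then show ?thesis using I(2) e(1-3) by (intro solvable_remove[of E e s t v y]) auto
qed

lemma deg_flip: "deg E s t q p A = deg E s t p q A"
  by (simp add: deg_def)

text \<open>Two edges at \<open>v\<close> to distinct neighbours, or an edge and a root arc, can be
  lifted. Otherwise \<open>v\<close> has at most one neighbour and no root arcs, and is merged into
  another vertex.\<close>

lemma solvable_exempt:
  fixes W :: "'v set" and E :: "'e set"
  assumes k: "k > 0"
    and adm: "admissible k W E s t p q b v" and v: "v \<in> W" and W: "W \<noteq> {v}"
    and exempt: "2*k dvd b v"
    and slack: "\<And>A. A \<subset> W \<Longrightarrow> 2 \<le> card A \<Longrightarrow> 2*k + mod_dist k (sum b A) \<le> deg E s t p q A"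
    and IH1: "\<And>(W' :: 'v set) (E' :: 'e set) s' t' p' q' b' w'. card W' < card W \<Longrightarrow>
        admissible k W' E' s' t' p' q' b' w' \<Longrightarrow> solvable k W' E' s' t' p' q' b'"
    and IH2: "\<And>(E' :: 'e set) s' t' p' q' b' w'. card E' < card E \<Longrightarrow>
        admissible k W E' s' t' p' q' b' w' \<Longrightarrow> solvable k W E' s' t' p' q' b'"
  shows "solvable k W E s t p q b"
proof -
  note I = admissibleD[OF adm]
  define oth where "oth e = (if s e = v then t e else s e)" for e
  define L where "L = {e\<in>E. (s e = v) \<noteq> (t e = v)}"
  have L: "e \<in> E" "joins s t e v (oth e)" "oth e \<noteq> v" "oth e \<in> W" if "e \<in> L" for e
    using that I(3,4) by (auto simp: L_def oth_def joins_def)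
  obtain y0 where y0: "y0 \<in> W" "y0 \<noteq> v" using v W by blast
  have merge: "solvable k W E s t p q b" if y: "y \<in> W" "y \<noteq> v" "p v = 0" "q v = 0" "\<And>e. e \<in> L \<Longrightarrow> oth e = y" for y
  proof -
    let ?n = "deg E s t p q {v}"
    have "0 \<le> ?n" using y by (simp add: deg_def cut_def sum_nonneg)
    moreover have "even (b v)" using exempt by (meson dvd_mult_left)
    then have "even ?n" using I(7)[of "{v}"] v by simp
    \<comment> \<open>Half of the edges leave \<open>v\<close>; its degree is even because
      \<open>b v\<close> is.\<close>
    ultimately have j: "0 \<le> ?n div 2" "?n div 2 \<le> ?n" "2*k dvd (2 * (?n div 2) - ?n) - b v"
      using exempt by auto
    have nbr: "t e \<in> {v, y}" if "e \<in> E" "s e = v" for e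
      using y(5)[of e] that by (auto simp: L_def oth_def)
    have nbr': "s e \<in> {v, y}" if "e \<in> E" "t e = v" for e
      using y(5)[of e] that by (auto simp: L_def oth_def)
    show ?thesis
      by (rule solvable_merge[OF adm v y(1) y(2)[symmetric] y(3,4) nbr nbr' j IH1])
  qed
  show ?thesis
  proof (cases "L = {}")
    case True
    then have cv: "cut E s t {v} = 0" unfolding cut_def by (intro sum.neutral) (auto simp: L_def)
    have sW: "sum f W = f v + sum f (W - {v})" for f :: "'v \<Rightarrow> int" using I(1) v by (rule sum.remove)
    have "cut E s t (W - {v}) = cut E s t {v}" unfolding cut_def
      using I(3,4) by (intro sum.cong) auto
    then have dW: "deg E s t p q (W - {v}) = sum p (W - {v}) + sum q (W - {v})" using cv by (simp add: deg_def)
    have "W - {v} \<noteq> {}" "W - {v} \<subset> W" "\<not> (W - {v} = {v} \<and> 2*k dvd b v)" using y0 v by auto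
    \<comment> \<open>No edge crosses, so the root arcs at \<open>W - {v}\<close> alone meet the cut
      condition there. The upper bound on all root arcs then leaves room for at most
      \<open>mod_dist k (b v)\<close> of them at \<open>v\<close>, that is, none.\<close>
    from I(10)[OF this] have "p v + q v + mod_dist k (sum b (W - {v})) \<le> mod_dist k (sum b W)"
      using I(9) dW sW[of p] sW[of q] by linarith
    moreover have "mod_dist k (sum b W) \<le> mod_dist k (b v) + mod_dist k (sum b (W - {v}))"
      unfolding sW[of b] by (rule mod_dist_subadd[OF k])
    moreover have "mod_dist k (b v) = 0" using exempt mod_dist_eq_0[OF k] by blast
    ultimately have "p v = 0" "q v = 0" using I(5,6)[OF v] by auto
    then show ?thesis using y0 True by (intro merge) auto
  next
    case False
    then obtain e where e: "e \<in> L" by blast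
    show ?thesis
    proof (cases "\<exists>f\<in>L. oth f \<noteq> oth e")
      case True
      then obtain f where f: "f \<in> L" "oth f \<noteq> oth e" by blast
      show ?thesis
        by (rule solvable_lift_edges[OF adm v exempt slack L(1)[OF f(1)] L(1)[OF e] L(2)[OF f(1)] L(2)[OF e]
              f(2) L(3)[OF f(1)] L(3)[OF e] IH2])
    next
      case same: False
      consider "p v > 0" | "q v > 0" | "p v = 0" "q v = 0" using I(5,6)[OF v] by linarith
      then show ?thesis
      proof cases
        case 1
        show ?thesis by (rule solvable_lift_root[OF adm v exempt slack L(1-3)[OF e] 1 IH2])
      next
        case 2
        have "solvable k W E s t q p (\<lambda>v. - b v)"
        proof (rule solvable_lift_root[OF admissible_flip[OF k adm] v _ _ L(1-3)[OF e] 2 IH2])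
          show "2*k dvd - b v" using exempt by simp
          show "2*k + mod_dist k (sum (\<lambda>v. - b v) A) \<le> deg E s t q p A" if "A \<subset> W" "2 \<le> card A" for A
            using slack[OF that] by (simp add: sum_negf mod_dist_uminus[OF k] deg_flip)
        qed
        then show ?thesis by (rule solvable_flip)
      next
        case 3
        then show ?thesis using same L[OF e] by (intro merge[of "oth e"]) auto
      qed
    qed
  qed
qed

section \<open>Deleting edges and root arcs\<close>

lemma admissible_update:
  assumes adm: "admissible k W E s t p q b w" and k: "k > 0"
    and E': "E' \<subseteq> E"
    and pq: "\<And>u. u \<in> W \<Longrightarrow> 0 \<le> p' u \<and> 0 \<le> q' u"
    and sumW: "2*k dvd sum b' W + sum p' W - sum q' W"
      "sum p' W + sum q' W \<le> 2*k - 2 + mod_dist k (sum b' W)"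
    and par: "\<And>A. A \<subseteq> W \<Longrightarrow> even (deg E' s t p' q' A - deg E s t p q A - (sum b' A - sum b A))"
    and single: "\<And>u. u \<in> W \<Longrightarrow> 2*k - 2 + mod_dist k (b' u) \<le> deg E' s t p' q' {u}"
    and multi: "\<And>A. A \<subset> W \<Longrightarrow> 2 \<le> card A \<Longrightarrow> 2*k - 2 + mod_dist k (sum b' A) \<le> deg E' s t p' q' A"
  shows "admissible k W E' s t p' q' b' w"
proof -
  note I = admissibleD[OF adm]
  show ?thesis unfolding admissible_def
  proof (intro conjI ballI allI impI)
    fix A assume A: "A \<subseteq> W"
    have "deg E' s t p' q' A - sum b' A =
      (deg E' s t p' q' A - deg E s t p q A - (sum b' A - sum b A)) + (deg E s t p q A - sum b A)" by simp
    then show "even (deg E' s t p' q' A - sum b' A)" using dvd_add[OF par[OF A] I(7)[OF A]] by metis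
  next
    fix A assume A: "A \<noteq> {}" "A \<subset> W"
    have "finite A" using A(2) I(1) finite_subset by blast
    then have "card A \<noteq> 0" using A(1) by simp
    then consider u where "A = {u}" | "2 \<le> card A"
      by (metis One_nat_def card_1_singletonE less_2_cases not_less)
    then show "2*k - 2 + mod_dist k (sum b' A) \<le> deg E' s t p' q' A"
      using single multi A by cases auto
  qed (use I(1-4) finite_subset[OF E'] E' pq sumW in auto)
qed

lemma deg_remove:
  assumes "finite E" "e \<in> E" "joins s t e x y"
  shows "deg (E - {e}) s t p q A = deg E s t p q A - of_bool ((x \<in> A) \<noteq> (y \<in> A))"
proof -
  have "(of_bool ((s e \<in> A) \<noteq> (t e \<in> A)) :: int) = of_bool ((x \<in> A) \<noteq> (y \<in> A))"
    using assms(3) by (auto simp: joins_def)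
  then show ?thesis unfolding deg_def cut_remove[OF assms(1,2)] by simp
qed

text \<open>Without such an edge, \<open>A\<close> and \<open>W - A\<close> would each need at least
  \<open>2*k - 2\<close> root arcs, while the root has at most \<open>3*k - 2\<close>; this is
  impossible for \<open>k\<close> at least 3.\<close>

lemma crossing_edge:
  assumes k: "k \<ge> 3" and adm: "admissible k W E s t p q b w"
    and A: "A \<noteq> {}" "A \<subset> W" and nd: "\<And>v. v \<in> W \<Longrightarrow> \<not> 2*k dvd b v"
  obtains e x y where "e \<in> E" "joins s t e x y" "x \<in> A" "y \<in> W - A"
proof -
  note I = admissibleD[OF adm]
  have "\<exists>e\<in>E. (s e \<in> A) \<noteq> (t e \<in> A)"
  proof (rule ccontr)
    assume "\<not> ?thesis"
    then have *: "\<And>e. e \<in> E \<Longrightarrow> (s e \<in> A) = (t e \<in> A)" by auto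
    then have 1: "cut E s t A = 0" unfolding cut_def by (intro sum.neutral) auto
    have 2: "cut E s t (W - A) = 0" unfolding cut_def using * I(3,4) by (intro sum.neutral) auto
    have sW: "sum f W = sum f (W - A) + sum f A" for f :: "'a \<Rightarrow> int"
      using I(1) A(2) by (intro sum.subset_diff) auto
    have "2*k - 2 + mod_dist k (sum b A) \<le> deg E s t p q A" using A nd by (intro I(10)) auto
    moreover have "2*k - 2 + mod_dist k (sum b (W - A)) \<le> deg E s t p q (W - A)"
    proof (rule I(10))
      show "\<not> (W - A = {w} \<and> 2*k dvd b w)" using nd by blast
    qed (use A in auto)
    moreover have "mod_dist k (sum b A) \<ge> 0" "mod_dist k (sum b (W - A)) \<ge> 0" "mod_dist k (sum b W) \<le> k"
      using k by (auto intro: mod_dist_nonneg mod_dist_le_k)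
    ultimately show False using I(9) k sW[of p] sW[of q] 1 2 unfolding deg_def by linarith
  qed
  then obtain e where e: "e \<in> E" "(s e \<in> A) \<noteq> (t e \<in> A)" by blast
  show ?thesis
  proof (cases "s e \<in> A")
    case True
    then show ?thesis using e I(3,4)[OF e(1)] by (intro that[of e "s e" "t e"]) (auto simp: joins_def)
  next
    case False
    then show ?thesis using e I(3,4)[OF e(1)] by (intro that[of e "t e" "s e"]) (auto simp: joins_def)
  qed
qed

text \<open>The instances on which neither contraction of a tight set nor splitting off applies. A
  vertex is called positive if its residue is at most \<open>k\<close>.\<close>

locale reduced =
  fixes k :: int and W :: "'v set" and E :: "'e set" and s t p q b w
  assumes k: "k \<ge> 3"
    and adm: "admissible k W E s t p q b w"
    and W2: "2 \<le> card W"
    and nd: "\<And>v. v \<in> W \<Longrightarrow> \<not> 2*k dvd b v"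
    and slack: "\<And>A. A \<subset> W \<Longrightarrow> 2 \<le> card A \<Longrightarrow> 2*k + mod_dist k (sum b A) \<le> deg E s t p q A"
begin

lemmas I = admissibleD[OF adm]

lemma k0: "k > 0" using k by simp

lemma single: "u \<in> W \<Longrightarrow> 2*k - 2 + mod_dist k (b u) \<le> deg E s t p q {u}"
proof -
  assume u: "u \<in> W"
  then have "{u} \<subset> W" using W2 by auto
  then show ?thesis using I(10)[of "{u}"] nd[OF u] by auto
qed

lemma fin: "A \<subseteq> W \<Longrightarrow> finite A" using I(1) finite_subset by blast

text \<open>At a positive \<open>v\<close> the degree and the distance both drop by 1. The
  congruences stay the same because \<open>b - q\<close> does, and at the root the loss of an arc
  pays for a change of distance by 1.\<close>

lemma delete_root_arc:
  assumes v: "v \<in> W" "b v mod (2*k) \<le> k" "0 < q v"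
    and sol: "admissible k W E s t p (q(v := q v - 1)) (b(v := b v - 1)) w \<Longrightarrow>
      solvable k W E s t p (q(v := q v - 1)) (b(v := b v - 1))"
  shows "solvable k W E s t p q b"
proof -
  let ?q = "q(v := q v - 1)" and ?b = "b(v := b v - 1)"
  have sums: "sum ?q A = sum q A - of_bool (v \<in> A)" "sum ?b A = sum b A - of_bool (v \<in> A)" if "A \<subseteq> W" for A
    by (simp_all only: sum_upd[OF fin[OF that]]) simp_all
  have d: "deg E s t p ?q A = deg E s t p q A - of_bool (v \<in> A)" if "A \<subseteq> W" for A
    unfolding deg_def sums[OF that] by simp
  have le: "mod_dist k (sum b A - 1) \<le> mod_dist k (sum b A) + 1" for A
    using mod_dist_add_le[OF k0, of "sum b A" "-1"] by simp
  have "admissible k W E s t p ?q ?b w"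
  proof (rule admissible_update[OF adm k0])
    show "sum p W + sum ?q W \<le> 2*k - 2 + mod_dist k (sum ?b W)"
      using I(9) mod_dist_add_le[OF k0, of "sum b W - 1" 1] v(1) by (simp only: sums[OF subset_refl]) simp
    show "2*k dvd sum ?b W + sum p W - sum ?q W" using I(8) v(1) by (simp only: sums[OF subset_refl]) (simp add: algebra_simps)
    fix u assume u: "u \<in> W"
    show "2*k - 2 + mod_dist k (?b u) \<le> deg E s t p ?q {u}"
      using single[OF u] mod_dist_pred[OF k0 nd[OF v(1)] v(2)] u by (auto simp: d)
  next
    fix A assume A: "A \<subset> W" "2 \<le> card A"
    then have AW: "A \<subseteq> W" by auto
    show "2*k - 2 + mod_dist k (sum ?b A) \<le> deg E s t p ?q A"
      unfolding d[OF AW] sums[OF AW] using slack[OF A] le[of A] by (cases "v \<in> A") simp_all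
  next
    fix A assume A: "A \<subseteq> W"
    show "even (deg E s t p ?q A - deg E s t p q A - (sum ?b A - sum b A))"
      unfolding d[OF A] sums[OF A] by simp
  next
    fix u assume "u \<in> W"
    then show "0 \<le> p u \<and> 0 \<le> ?q u" using I(5,6) v by auto
  qed auto
  from sol[OF this] have "solvable k W E s t p ?q ?b" .
  moreover have eq: "?b u + p u - ?q u = b u + p u - q u" for u by simp
  ultimately show ?thesis unfolding solvable_def eq by blast
qed

text \<open>Oriented from the positive to the negative end, the deleted edge moves both residues
  towards 0, so both singletons stay admissible.\<close>

lemma remove_mixed_edge:
  assumes e: "e \<in> E" "joins s t e x y" "x \<in> W" "y \<in> W" "x \<noteq> y"
    and sgn: "b x mod (2*k) \<le> k" "k \<le> b y mod (2*k)"
    and sol: "admissible k W (E - {e}) s t p q (b(x := b x - 1, y := b y + 1)) w \<Longrightarrow>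
      solvable k W (E - {e}) s t p q (b(x := b x - 1, y := b y + 1))"
  shows "solvable k W E s t p q b"
proof -
  let ?b = "b(x := b x - 1, y := b y + 1)"
  have sums: "sum ?b A = sum b A - of_bool (x \<in> A) + of_bool (y \<in> A)" if "A \<subseteq> W" for A
    using e(5) by (simp only: sum_upd[OF fin[OF that]]) simp
  note d = deg_remove[OF I(2) e(1,2)]
  have "admissible k W (E - {e}) s t p q ?b w"
  proof (rule admissible_update[OF adm k0])
    show "sum p W + sum q W \<le> 2*k - 2 + mod_dist k (sum ?b W)"
      using I(9) e by (simp only: sums) simp
    show "2*k dvd sum ?b W + sum p W - sum q W" using I(8) e by (simp only: sums) simp
    fix u assume u: "u \<in> W"
    show "2*k - 2 + mod_dist k (?b u) \<le> deg (E - {e}) s t p q {u}"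
      using single[OF u] mod_dist_pred[OF k0 nd[OF e(3)] sgn(1)] mod_dist_succ[OF k0 sgn(2)] u e(5) by (auto simp: d)
  next
    fix A assume A: "A \<subset> W" "2 \<le> card A"
    then have "sum ?b A = sum b A - of_bool (x \<in> A) + of_bool (y \<in> A)" by (intro sums) auto
    then show "2*k - 2 + mod_dist k (sum ?b A) \<le> deg (E - {e}) s t p q A"
      using slack[OF A] mod_dist_add_le[OF k0, of "sum b A" "-1"] mod_dist_add_le[OF k0, of "sum b A" "1"]
      by (cases "x \<in> A"; cases "y \<in> A") (simp_all add: d)
  next
    fix A assume A: "A \<subseteq> W"
    show "even (deg (E - {e}) s t p q A - deg E s t p q A - (sum ?b A - sum b A))"
      unfolding d sums[OF A] by (cases "x \<in> A"; cases "y \<in> A") simp_all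
  qed (use I(5,6) in auto)
  from sol[OF this] show ?thesis
    using e by (intro solvable_remove[OF I(2) e(1,2)]) auto
qed

text \<open>
  Adding \<open>k - 1\<close> arcs from \<open>y\<close> to the root turns the positive vertex \<open>y\<close> into a negative one without
  violating any cut condition. Then \<open>e\<close> joins vertices of opposite sign and can be deleted.
\<close>

lemma remove_positive_edge:
  assumes e: "e \<in> E" "joins s t e v y" "v \<in> W" "y \<in> W" "v \<noteq> y"
    and sgn: "b v mod (2*k) \<le> k" "b y mod (2*k) \<le> k"
    and q0: "\<And>u. u \<in> W \<Longrightarrow> q u = 0"
    and sol: "admissible k W (E - {e}) s t p (q(y := k - 1)) (b(v := b v - 1, y := b y + k)) w \<Longrightarrow>
      solvable k W (E - {e}) s t p (q(y := k - 1)) (b(v := b v - 1, y := b y + k))"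
    and odd: "odd k"
  shows "solvable k W E s t p q b"
proof -
  \<comment> \<open>The increment \<open>k\<close> consists of \<open>k - 1\<close> for the new arcs
    leaving \<open>y\<close> and 1 for the deleted edge, which enters \<open>y\<close>.\<close>
  let ?b = "b(v := b v - 1, y := b y + k)" and ?q = "q(y := k - 1)"
  have sums: "sum ?b A = sum b A - of_bool (v \<in> A) + k * of_bool (y \<in> A)"
    "sum ?q A = sum q A + (k - 1) * of_bool (y \<in> A)" if "A \<subseteq> W" for A
    using e(5) q0[OF e(4)] by (simp_all only: sum_upd[OF fin[OF that]]) simp_all
  have d: "deg (E - {e}) s t p ?q A = deg E s t p q A - of_bool ((v \<in> A) \<noteq> (y \<in> A)) + (k - 1) * of_bool (y \<in> A)"
    if "A \<subseteq> W" for A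
  proof -
    have "deg (E - {e}) s t p ?q A = deg (E - {e}) s t p q A + (k - 1) * of_bool (y \<in> A)"
      unfolding deg_def sums[OF that] by simp
    then show ?thesis by (simp add: deg_remove[OF I(2) e(1,2)])
  qed
  have nmy: "mod_dist k (b y + k) = k - mod_dist k (b y)"
  proof -
    have "mod_dist k (b y + k) = mod_dist k (b y + (- k))" by (rule mod_dist_cong) simp
    also have "\<dots> = \<bar>b y mod (2*k) + (- k)\<bar>" using sgn k0 by (intro mod_dist_shift) auto
    finally show ?thesis using mod_dist_mod_le[OF k0 sgn(2)] sgn by simp
  qed
  \<comment> \<open>The degree of \<open>y\<close> grows by \<open>k - 2\<close> while its distance
    \<open>d\<close> becomes \<open>k - d\<close>; the cut condition at \<open>y\<close> survives
    exactly because \<open>d\<close> is at least 1.\<close>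
  have nmy1: "mod_dist k (b y) \<ge> 1" using mod_dist_nonneg[OF k0, of "b y"] mod_dist_eq_0[OF k0, of "b y"] nd[OF e(4)] by linarith
  \<comment> \<open>With \<open>r\<close> arcs from the root and none into it, the total boundary is
    \<open>- r\<close> modulo \<open>2*k\<close>. The old root condition then forces
    \<open>r\<close> below \<open>2*k\<close>, so the new distance is the absolute value of
    \<open>r - (k - 1)\<close>, and the new condition follows.\<close>
  have root: "sum p W + (k - 1) \<le> 2*k - 2 + mod_dist k (sum b W + (k - 1))"
  proof -
    define r where "r = sum p W"
    have r0: "0 \<le> r" unfolding r_def using I(5) by (intro sum_nonneg) auto
    have q0': "sum q W = 0" using q0 by (intro sum.neutral) auto
    then have z: "2*k dvd sum b W + r" using I(8) by (simp add: r_def)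
    have "mod_dist k (sum b W) = mod_dist k (- r)" using z by (intro mod_dist_cong) simp
    then have "r \<le> 2*k - 2 + mod_dist k r" using I(9) q0' by (simp add: r_def mod_dist_uminus[OF k0])
    moreover have "mod_dist k r \<le> \<bar>r - 2*k*1\<bar>" by (rule mod_dist_le[OF k0])
    ultimately have r1: "r \<le> 2*k - 1" by linarith
    have "mod_dist k (sum b W + (k - 1)) = mod_dist k (- (r - k + 1))" using z by (intro mod_dist_cong) (simp add: algebra_simps)
    also have "\<dots> = \<bar>r - k + 1\<bar>" unfolding mod_dist_uminus[OF k0] using r0 r1 by (intro mod_dist_eq_abs[OF k0]) auto
    finally show ?thesis unfolding r_def[symmetric] by linarith
  qed
  have "admissible k W (E - {e}) s t p ?q ?b w"
  proof (rule admissible_update[OF adm k0])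
    have q0': "sum q W = 0" using q0 by (intro sum.neutral) auto
    have eq: "sum ?b W = sum b W + (k - 1)" "sum ?q W = k - 1"
      using e q0' by (simp_all only: sums[OF subset_refl]) simp_all
    show "sum p W + sum ?q W \<le> 2*k - 2 + mod_dist k (sum ?b W)" unfolding eq by (rule root)
    show "2*k dvd sum ?b W + sum p W - sum ?q W" unfolding eq using I(8) q0' by (simp add: add.commute)
    fix u assume u: "u \<in> W"
    consider "u = v" | "u = y" | "u \<noteq> v" "u \<noteq> y" by blast
    then show "2*k - 2 + mod_dist k (?b u) \<le> deg (E - {e}) s t p ?q {u}"
    proof cases
      case 1
      then show ?thesis using single[OF u] mod_dist_pred[OF k0 nd[OF e(3)] sgn(1)] u e(5) by (simp add: d)
    next
      case 2
      then show ?thesis using single[OF u] nmy nmy1 u e(5) k by (simp add: d)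
    next
      case 3
      then show ?thesis using single[OF u] u by (simp add: d)
    qed
  next
    fix A assume A: "A \<subset> W" "2 \<le> card A"
    then have AW: "A \<subseteq> W" by auto
    show "2*k - 2 + mod_dist k (sum ?b A) \<le> deg (E - {e}) s t p ?q A"
      unfolding sums[OF AW] d[OF AW]
      using slack[OF A] mod_dist_add_le[OF k0, of "sum b A" "-1"] mod_dist_add_le[OF k0, of "sum b A" k]
        mod_dist_add_le[OF k0, of "sum b A" "k - 1"] k
      by (cases "v \<in> A"; cases "y \<in> A") (simp_all add: algebra_simps)
  next
    fix A assume A: "A \<subseteq> W"
    show "even (deg (E - {e}) s t p ?q A - deg E s t p q A - (sum ?b A - sum b A))"
      unfolding d[OF A] sums[OF A] using odd by (cases "v \<in> A"; cases "y \<in> A") simp_all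
  next
    fix u assume "u \<in> W"
    then show "0 \<le> p u \<and> 0 \<le> ?q u" using I(5,6) k by auto
  qed auto
  from sol[OF this] show ?thesis
    using e q0 by (intro solvable_remove[OF I(2) e(1,2)]) auto
qed

text \<open>Arcs into the root are removed one at a time, since the sign change of a vertex relies
  on there being none; then an edge can be deleted.\<close>

lemma solvable_positive:
  assumes pos: "\<And>v. v \<in> W \<Longrightarrow> b v mod (2*k) \<le> k" and odd: "odd k"
    and IH2: "\<And>(E' :: 'e set) s' t' p' q' b' w'. card E' < card E \<Longrightarrow>
        admissible k W E' s' t' p' q' b' w' \<Longrightarrow> solvable k W E' s' t' p' q' b'"
    and IH3: "\<And>p' q' b' w'. sum p' W + sum q' W < sum p W + sum q W \<Longrightarrow>
        admissible k W E s t p' q' b' w' \<Longrightarrow> solvable k W E s t p' q' b'"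
  shows "solvable k W E s t p q b"
proof (cases "\<exists>v\<in>W. q v > 0")
  case True
  then obtain v where v: "v \<in> W" "q v > 0" by blast
  have "sum (q(v := q v - 1)) W = sum q W - 1" unfolding sum_upd[OF I(1)] using v by simp
  then show ?thesis by (intro delete_root_arc[OF v(1) pos[OF v(1)] v(2)] IH3) auto
next
  case False
  then have q0: "\<And>u. u \<in> W \<Longrightarrow> q u = 0" using I(6) by force
  obtain v where v: "v \<in> W" using W2 by fastforce
  have "{v} \<noteq> {}" "{v} \<subset> W" using v W2 by auto
  from crossing_edge[OF k adm this nd] obtain e x y
    where e: "e \<in> E" "joins s t e x y" "x \<in> {v}" "y \<in> W - {v}" by blast
  have "card (E - {e}) < card E" using e(1) I(2) by (intro card_Diff1_less) auto
  then show ?thesis using e v q0 pos odd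
    by (intro remove_positive_edge[of e v y] IH2) auto
qed

end

theorem solvable_admissible:
  fixes W :: "'v set" and E :: "'e set"
  assumes odd: "odd k" and k: "k \<ge> 3" and "admissible k W E s t p q b w"
  shows "solvable k W E s t p q b"
proof -
  \<comment> \<open>Edges rank before root arcs because deleting an edge between positive vertices
    creates root arcs.\<close>
  have wf: "wf (less_than <*lex*> less_than <*lex*> less_than)" by blast
  show ?thesis using assms(3)
  proof (induction "(card W, card E, nat (sum p W + sum q W))" arbitrary: W E s t p q b w
      rule: wf_induct_rule[OF wf])
    case (1 W E p q s t b w)
    note adm = 1(2)
    note I = admissibleD[OF adm]
    have k0: "k > 0" using k by simp
    have IH1: "solvable k W' E' s' t' p' q' b'"
      if "card W' < card W" "admissible k W' E' s' t' p' q' b' w'" for W' :: "'v set" and E' :: "'e set" and s' t' p' q' b' w'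
      using that by (intro 1(1)[OF _ that(2)]) auto
    have IH2: "solvable k W E' s' t' p' q' b'"
      if "card E' < card E" "admissible k W E' s' t' p' q' b' w'" for E' :: "'e set" and s' t' p' q' b' w'
      using that by (intro 1(1)[OF _ that(2)]) auto
    have IH3: "solvable k W E s t p' q' b'"
      if "sum p' W + sum q' W < sum p W + sum q W" "admissible k W E s t p' q' b' w'" for p' q' b' w'
    proof (intro 1(1)[OF _ that(2)])
      have "0 \<le> sum p' W + sum q' W" using admissibleD(5,6)[OF that(2)] by (intro add_nonneg_nonneg sum_nonneg) auto
      then show "((card W, card E, nat (sum p' W + sum q' W)), card W, card E, nat (sum p W + sum q W))
        \<in> less_than <*lex*> less_than <*lex*> less_than" using that(1) by auto
    qed
    show ?case
    proof (cases "2 \<le> card W")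
      case False
      then consider "W = {}" | v where "W = {v}"
        using I(1) by (metis One_nat_def card_0_eq card_1_singletonE less_2_cases not_less)
      then show ?thesis
      proof cases
        case 1
        then show ?thesis unfolding solvable_def by (intro exI[of _ "\<lambda>_. 1"]) auto
      next
        case (2 v)
        have "net E s t (\<lambda>_. 1) v = 0" unfolding net_def using I(3,4) 2 by (intro sum.neutral) auto
        moreover have "2*k dvd - (b v + p v - q v)" using I(8) 2 by (simp only: dvd_minus_iff) simp
        ultimately show ?thesis unfolding solvable_def using 2 by (intro exI[of _ "\<lambda>_. 1"]) auto
      qed
    next
      case W2: True
      show ?thesis
      proof (cases "\<exists>A. A \<subset> W \<and> 2 \<le> card A \<and> deg E s t p q A \<le> 2*k - 2 + mod_dist k (sum b A)")
        case True
        then obtain A where "A \<subset> W" "2 \<le> card A" "deg E s t p q A \<le> 2*k - 2 + mod_dist k (sum b A)" by blast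
        from solvable_tight[OF adm this IH1] show ?thesis .
      next
        case False
        \<comment> \<open>Degree and distance have equal parity, so exceeding the bound means
          exceeding it by 2.\<close>
        have slack': "2*k + mod_dist k x \<le> d" if "2*k - 2 + mod_dist k x < d" "even (d - x)" for d x
        proof -
          have "even (d - mod_dist k x)" using mod_dist_parity[OF k0, of x] that(2) by presburger
          then have "d \<noteq> 2*k - 1 + mod_dist k x" by auto
          then show ?thesis using that(1) by linarith
        qed
        have slack: "2*k + mod_dist k (sum b A) \<le> deg E s t p q A" if "A \<subset> W" "2 \<le> card A" for A
          using False that I(7)[of A] by (intro slack') auto
        have W1: "W \<noteq> {v}" for v using W2 by auto
        consider (ex) "w \<in> W" "2*k dvd b w" | (dvd) v where "v \<in> W" "2*k dvd b v" "\<not> (w \<in> W \<and> 2*k dvd b w)"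
          | (nd) "\<And>v. v \<in> W \<Longrightarrow> \<not> 2*k dvd b v" by blast
        then show ?thesis
        proof cases
          case ex
          show ?thesis by (rule solvable_exempt[OF k0 adm ex(1) W1 ex(2) slack IH1 IH2])
        next
          case dvd
          \<comment> \<open>The vertex \<open>w\<close> currently exempts nothing, so the exemption
            can be handed to \<open>v\<close>.\<close>
          have "admissible k W E s t p q b v" unfolding admissible_def
          proof (intro conjI ballI allI impI)
            fix A assume A: "A \<noteq> {}" "A \<subset> W"
            have "\<not> (A = {w} \<and> 2*k dvd b w)" using A(2) dvd(3) by blast
            then show "2*k - 2 + mod_dist k (sum b A) \<le> deg E s t p q A" by (rule I(10)[OF A])
          qed (fact I | rule I, assumption)+
          from solvable_exempt[OF k0 this dvd(1) W1 dvd(2) slack IH1 IH2] show ?thesis .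
        next
          case nd
          interpret reduced k W E s t p q b w
            using k adm W2 nd slack by unfold_locales auto
          define P where "P = {v\<in>W. b v mod (2*k) \<le> k}"
          consider "P = W" | "P = {}" | "P \<noteq> {}" "P \<subset> W" by (auto simp: P_def)
          then show ?thesis
          proof cases
            case 1
            show ?thesis by (rule solvable_positive[OF _ odd IH2 IH3]) (use 1 in \<open>auto simp: P_def\<close>)
          next
            case 2
            interpret flip: reduced k W E s t q p "\<lambda>v. - b v" w
              using k admissible_flip[OF k0 adm] W2 nd slack
              by unfold_locales (auto simp: sum_negf mod_dist_uminus[OF k0] deg_flip)
            have "solvable k W E s t q p (\<lambda>v. - b v)"
            proof (rule flip.solvable_positive[OF _ odd IH2 IH3])
              fix v assume v: "v \<in> W"
              have "k < b v mod (2*k)" using 2 v by (auto simp: P_def)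
              then show "- b v mod (2*k) \<le> k" using k0 by (simp add: zmod_zminus1_eq_if)
            qed auto
            then show ?thesis by (rule solvable_flip)
          next
            case 3
            from crossing_edge[OF k adm 3 nd] obtain e x y
              where e: "e \<in> E" "joins s t e x y" "x \<in> P" "y \<in> W - P" by blast
            have "card (E - {e}) < card E" using e(1) I(2) by (intro card_Diff1_less) auto
            then show ?thesis using e by (intro remove_mixed_edge[of e x y] IH2) (auto simp: P_def)
          qed
        qed
      qed
    qed
  qed
qed

subsection \<open>Integer flows with nearly constant absolute value\<close>

definition outc :: "'e set \<Rightarrow> ('e \<Rightarrow> 'v) \<Rightarrow> ('e \<Rightarrow> 'v) \<Rightarrow> 'v set \<Rightarrow> int" where
  "outc E s t A = (\<Sum>e\<in>E. of_bool (s e \<in> A \<and> t e \<notin> A))"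

lemma sum_Un_Int_int:
  fixes j :: "'v \<Rightarrow> int"
  assumes "finite A" "finite B" shows "sum j (A \<inter> B) + sum j (A \<union> B) = sum j A + sum j B"
  using sum.union_inter[OF assms, of j] by simp

text \<open>The cut criterion for unit capacities, by induction on the edges. If \<open>e\<close>
  cannot be dropped, some set \<open>T\<close> left by \<open>e\<close> becomes violated; then
  \<open>e\<close> is used, and submodularity against \<open>T\<close> protects the sets that
  \<open>e\<close> enters.\<close>

lemma transshipment:
  fixes j :: "'v \<Rightarrow> int"
  assumes "finite E" and W: "finite W"
    and "\<And>e. e \<in> E \<Longrightarrow> s e \<in> W \<and> t e \<in> W"
    and "sum j W = 0" and "\<And>A. A \<subseteq> W \<Longrightarrow> sum j A \<le> outc E s t A"
  shows "\<exists>S\<subseteq>E. \<forall>v\<in>W. net S s t (\<lambda>_. 1) v = j v"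
  using assms(1,3-)
proof (induction E arbitrary: j rule: finite_induct)
  case empty
  have "j v = 0" if v: "v \<in> W" for v
  proof -
    have "sum j W = j v + sum j (W - {v})" using W v by (rule sum.remove)
    moreover have "sum j {v} \<le> 0" "sum j (W - {v}) \<le> 0"
      using empty(3)[of "{v}"] empty(3)[of "W - {v}"] v by (auto simp: outc_def)
    ultimately show ?thesis using empty(2) by simp
  qed
  then show ?case by (simp add: net_def)
next
  case (insert e F)
  have fin: "finite A" if "A \<subseteq> W" for A using that W finite_subset by blast
  have outc: "outc (insert e F) s t A = outc F s t A + of_bool (s e \<in> A \<and> t e \<notin> A)" for A
    unfolding outc_def using insert(1,2) by simp
  show ?case
  proof (cases "\<forall>A\<subseteq>W. sum j A \<le> outc F s t A")
    case True
    then obtain S where "S \<subseteq> F" "\<forall>v\<in>W. net S s t (\<lambda>_. 1) v = j v"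
      using insert.IH[of j] insert.prems(1,2) by blast
    then show ?thesis by (intro exI[of _ S]) auto
  next
    case False
    then obtain T where T: "T \<subseteq> W" "outc F s t T < sum j T" by (auto simp: not_le)
    then have "of_bool (s e \<in> T \<and> t e \<notin> T) \<noteq> (0::int)" using insert.prems(3)[OF T(1)] outc[of T] by linarith
    then have eT: "s e \<in> T" "t e \<notin> T" by simp_all
    then have T_tight: "sum j T = outc F s t T + 1" using T insert.prems(3)[OF T(1)] outc[of T] by simp
    define j' where "j' = j(s e := j (s e) - 1, t e := j (t e) + 1)"
    have ne: "s e \<noteq> t e" using eT by auto
    have j': "sum j' A = sum j A - of_bool (s e \<in> A) + of_bool (t e \<in> A)" if "A \<subseteq> W" for A
      unfolding j'_def using ne by (simp only: sum_upd[OF fin[OF that]]) simp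
    have bound: "sum j' A \<le> outc F s t A" if A: "A \<subseteq> W" for A
    proof (cases "t e \<in> A \<and> s e \<notin> A")
      case False
      then show ?thesis unfolding j'[OF A] using insert.prems(3)[OF A] outc[of A] by auto
    next
      case True
      have "outc F s t (T \<inter> A) + outc F s t (T \<union> A) \<le> outc F s t T + outc F s t A"
        unfolding outc_def sum.distrib[symmetric] by (intro sum_mono) auto
      \<comment> \<open>As \<open>e\<close> leaves \<open>T\<close> and enters \<open>A\<close>, it
        leaves neither the intersection nor the union, so the bounds do not count it.\<close>
      moreover have "sum j (T \<inter> A) \<le> outc F s t (T \<inter> A)" "sum j (T \<union> A) \<le> outc F s t (T \<union> A)"
        using insert.prems(3)[of "T \<inter> A"] insert.prems(3)[of "T \<union> A"] T(1) A True
        by (auto simp: outc)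
      moreover have "sum j (T \<inter> A) + sum j (T \<union> A) = sum j T + sum j A"
        using fin T(1) A by (intro sum_Un_Int_int) auto
      ultimately show ?thesis unfolding j'[OF A] using True T_tight by simp
    qed
    have "sum j' W = 0" using j'[of W] insert.prems(1)[of e] insert.prems(2) by simp
    then obtain S where S: "S \<subseteq> F" "\<forall>v\<in>W. net S s t (\<lambda>_. 1) v = j' v"
      using insert.IH[of j'] insert.prems(1) bound by blast
    have "finite S" "e \<notin> S" using S(1) insert(1,2) finite_subset by auto
    then have "net (insert e S) s t (\<lambda>_. 1) v = j v" if "v \<in> W" for v
      using S(2) that ne by (auto simp: net_def j'_def)
    then show ?thesis using S(1) by (intro exI[of _ "insert e S"]) auto
  qed
qed

text \<open>
  Tutte's argument: the value \<open>p\<close> on every oriented edge is a flow modulo \<open>2 p + 1\<close>, and lowering it by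
  \<open>2 p + 1\<close> on a suitable edge set makes it an integer flow.
\<close>

lemma flow_of_modular_orientation:
  fixes p :: int and \<epsilon> :: "'e \<Rightarrow> int"
  assumes p: "p \<ge> 0" and fin: "finite E" "finite W"
    and W: "\<And>e. e \<in> E \<Longrightarrow> s e \<in> W \<and> t e \<in> W"
    and \<epsilon>: "\<And>e. e \<in> E \<Longrightarrow> \<epsilon> e = 1 \<or> \<epsilon> e = -1"
    and net: "\<And>v. v \<in> W \<Longrightarrow> (2*p + 1) dvd net E s t \<epsilon> v"
  obtains f where "\<And>e. e \<in> E \<Longrightarrow> \<bar>f e\<bar> = p \<or> \<bar>f e\<bar> = p + 1" "\<And>v. v \<in> W \<Longrightarrow> net E s t f v = 0"
proof -
  let ?k = "2*p + 1"
  define s' t' where "s' e = (if \<epsilon> e = 1 then s e else t e)" and "t' e = (if \<epsilon> e = 1 then t e else s e)" for e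
  have net': "net E s t (\<lambda>e. \<epsilon> e * g e) v = net E s' t' g v" for g v
    unfolding net_def
  proof (rule sum.cong)
    fix e assume "e \<in> E"
    then show "\<epsilon> e * g e * (of_bool (s e = v) - of_bool (t e = v)) = g e * (of_bool (s' e = v) - of_bool (t' e = v))"
      using \<epsilon>[of e] by (auto simp: s'_def t'_def)
  qed simp
  \<comment> \<open>The excess at \<open>v\<close> in units of \<open>2*p + 1\<close>, to be
    cancelled by the lowered edges.\<close>
  define j where "j v = p * net E s t \<epsilon> v div ?k" for v
  have kj: "?k * j v = p * net E s' t' (\<lambda>_. 1) v" if "v \<in> W" for v
    using net[OF that] net'[of "\<lambda>_. 1" v] by (auto simp: j_def)
  have kj_sum: "?k * sum j A = p * (\<Sum>e\<in>E. of_bool (s' e \<in> A) - of_bool (t' e \<in> A))" if A: "A \<subseteq> W" for A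
  proof -
    have "?k * sum j A = p * (\<Sum>v\<in>A. net E s' t' (\<lambda>_. 1) v)"
      unfolding sum_distrib_left using kj A by (intro sum.cong) auto
    also have "(\<Sum>v\<in>A. net E s' t' (\<lambda>_. 1) v) = (\<Sum>e\<in>E. of_bool (s' e \<in> A) - of_bool (t' e \<in> A))"
      using finite_subset[OF A fin(2)] by (subst sum_net) auto
    finally show ?thesis .
  qed
  have "\<exists>S\<subseteq>E. \<forall>v\<in>W. net S s' t' (\<lambda>_. 1) v = j v"
  proof (rule transshipment[OF fin])
    have "(\<Sum>e\<in>E. of_bool (s' e \<in> W) - of_bool (t' e \<in> W) :: int) = 0"
      using W by (intro sum.neutral) (auto simp: s'_def t'_def)
    then show "sum j W = 0" using kj_sum[of W] p by simp
    fix A assume A: "A \<subseteq> W"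
    have nn: "0 \<le> outc E s' t' A" by (simp add: outc_def sum_nonneg)
    have "(\<Sum>e\<in>E. of_bool (s' e \<in> A) - of_bool (t' e \<in> A) :: int) \<le> outc E s' t' A"
      unfolding outc_def by (intro sum_mono) auto
    then have "?k * sum j A \<le> p * outc E s' t' A" unfolding kj_sum[OF A] using p by (rule mult_left_mono)
    also have "\<dots> \<le> ?k * outc E s' t' A" using nn p by (intro mult_right_mono) auto
    finally show "sum j A \<le> outc E s' t' A" using p by simp
  qed (use W in \<open>auto simp: s'_def t'_def\<close>)
  then obtain S where S: "S \<subseteq> E" "\<And>v. v \<in> W \<Longrightarrow> net S s' t' (\<lambda>_. 1) v = j v" by blast
  define f where "f e = \<epsilon> e * (p - ?k * of_bool (e \<in> S))" for e
  show ?thesis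
  proof
    show "\<bar>f e\<bar> = p \<or> \<bar>f e\<bar> = p + 1" if "e \<in> E" for e
      using \<epsilon>[OF that] p by (auto simp: f_def)
    fix v assume v: "v \<in> W"
    have "net E s t f v = net E s' t' (\<lambda>e. p - ?k * of_bool (e \<in> S)) v"
      unfolding f_def by (rule net')
    also have "\<dots> = p * net E s' t' (\<lambda>_. 1) v - ?k * (\<Sum>e\<in>E. of_bool (e \<in> S) * (of_bool (s' e = v) - of_bool (t' e = v)))"
      unfolding net_def sum_distrib_left sum_subtractf[symmetric] by (intro sum.cong) (auto simp: algebra_simps)
    also have "(\<Sum>e\<in>E. of_bool (e \<in> S) * (of_bool (s' e = v) - of_bool (t' e = v))) = net S s' t' (\<lambda>_. 1) v"
      unfolding net_def using fin(1) S(1) by (intro sum.mono_neutral_cong_right) auto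
    finally show "net E s t f v = 0" using kj[OF v] S(2)[OF v] by simp
  qed
qed

lemma circular_flow:
  fixes p :: nat and s t :: "'e \<Rightarrow> 'v"
  assumes fin: "finite E" "finite W"
    and W: "\<And>e. e \<in> E \<Longrightarrow> s e \<in> W \<and> t e \<in> W \<and> s e \<noteq> t e"
    and p: "p > 0"
    and conn: "\<And>A. A \<noteq> {} \<Longrightarrow> A \<subset> W \<Longrightarrow> 6 * int p \<le> cut E s t A"
  obtains f where "\<And>e. e \<in> E \<Longrightarrow> \<bar>f e\<bar> = int p \<or> \<bar>f e\<bar> = int p + 1" "\<And>v. v \<in> W \<Longrightarrow> net E s t f v = 0"
proof -
  define k where "k = 2 * int p + 1"
  have k: "odd k" "k \<ge> 3" "k > 0" using p by (auto simp: k_def)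
  \<comment> \<open>The boundary must be a multiple of \<open>k\<close> with the parity of the
    degree; as \<open>k\<close> is odd, 0 and \<open>k\<close> suffice.\<close>
  define m :: "'v \<Rightarrow> int" where "m v = of_bool (odd (cut E s t {v}))" for v
  define b where "b v = k * m v" for v
  have b: "sum b A = k * sum m A" for A by (simp add: b_def sum_distrib_left)
  have par: "even (cut E s t A - sum m A)" if A: "A \<subseteq> W" for A
  proof -
    have finA: "finite A" using A fin(2) finite_subset by blast
    have "(\<Sum>v\<in>A. cut E s t {v}) = (\<Sum>e\<in>E. \<Sum>v\<in>A. of_bool (s e = v) + of_bool (t e = v))"
      unfolding cut_def by (subst sum.swap) (use W in \<open>auto intro!: sum.cong\<close>)
    also have "\<dots> = (\<Sum>e\<in>E. of_bool (s e \<in> A) + of_bool (t e \<in> A))"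
      by (simp add: sum.distrib sum_of_bool_eq[OF finA])
    also have "\<dots> = cut E s t A + 2 * (\<Sum>e\<in>E. of_bool (s e \<in> A \<and> t e \<in> A))"
      unfolding cut_def sum_distrib_left sum.distrib[symmetric] by (intro sum.cong) auto
    finally have "even (cut E s t A - (\<Sum>v\<in>A. cut E s t {v}))" by simp
    moreover have "even (\<Sum>v\<in>A. cut E s t {v} - m v)"
      by (intro dvd_sum) (auto simp: m_def)
    then have "even ((\<Sum>v\<in>A. cut E s t {v}) - sum m A)" by (simp add: sum_subtractf)
    ultimately show ?thesis by simp
  qed
  \<comment> \<open>All cut conditions hold without an exemption, so the exempt vertex can be
    arbitrary.\<close>
  have "admissible k W E s t (\<lambda>_. 0) (\<lambda>_. 0) b undefined"
    unfolding admissible_def deg_def b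
  proof (intro conjI ballI allI impI)
    fix A assume "A \<subseteq> W"
    then show "even (cut E s t A + (\<Sum>_\<in>A. 0) + (\<Sum>_\<in>A. 0) - k * sum m A)" using par[of A] k(1) by simp
  next
    have "cut E s t W = 0" unfolding cut_def using W by (intro sum.neutral) auto
    then have "even (sum m W)" using par[of W] by simp
    then show "2*k dvd k * sum m W + (\<Sum>_\<in>W. 0) - (\<Sum>_\<in>W. 0)" by (auto elim!: evenE)
    show "(\<Sum>_\<in>W. 0) + (\<Sum>_\<in>W. 0) \<le> 2*k - 2 + mod_dist k (k * sum m W)" using mod_dist_nonneg[OF k(3)] k(2) by (simp add: add_nonneg_nonneg)
  next
    fix A assume A: "A \<noteq> {}" "A \<subset> W"
    have "2*k - 2 + mod_dist k (k * sum m A) \<le> cut E s t A"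
    proof (cases "even (sum m A)")
      case True
      then have "2*k dvd k * sum m A" by (auto elim!: evenE)
      then have "mod_dist k (k * sum m A) = 0" using mod_dist_eq_0[OF k(3)] by blast
      then show ?thesis using conn[OF A] by (simp add: k_def)
    next
      case False
      then have "odd (cut E s t A)" using par[of A] A by auto
      then have "6 * int p + 1 \<le> cut E s t A" using conn[OF A] by (cases "cut E s t A = 6 * int p") auto
      then show ?thesis using mod_dist_le_k[OF k(3), of "k * sum m A"] by (simp add: k_def)
    qed
    then show "2*k - 2 + mod_dist k (k * sum m A) \<le> cut E s t A + (\<Sum>_\<in>A. 0) + (\<Sum>_\<in>A. 0)" by simp
  qed (use fin W in auto)
  from solvable_admissible[OF k(1,2) this] obtain \<epsilon> where
    \<epsilon>: "\<And>e. e \<in> E \<Longrightarrow> \<epsilon> e = 1 \<or> \<epsilon> e = -1" "\<And>v. v \<in> W \<Longrightarrow> 2*k dvd net E s t \<epsilon> v - b v"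
    unfolding solvable_def by auto
  have "(2 * int p + 1) dvd net E s t \<epsilon> v" if "v \<in> W" for v
  proof -
    have "k dvd net E s t \<epsilon> v - b v" using \<epsilon>(2)[OF that] by (rule dvd_mult_right)
    then have "k dvd (net E s t \<epsilon> v - b v) + b v" by (rule dvd_add) (simp add: b_def)
    then show ?thesis by (simp add: k_def)
  qed
  with fin W \<epsilon>(1) obtain f where "\<And>e. e \<in> E \<Longrightarrow> \<bar>f e\<bar> = int p \<or> \<bar>f e\<bar> = int p + 1" "\<And>v. v \<in> W \<Longrightarrow> net E s t f v = 0"
    using flow_of_modular_orientation[of "int p" E W s t \<epsilon>] by (metis of_nat_0_le_iff)
  then show ?thesis by (rule that)
qed

subsection \<open>Disjoint branchings\<close>

lemma in_arcs_submodular: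
  assumes "finite E"
  shows "card (in_arcs E s t (U \<inter> U')) + card (in_arcs E s t (U \<union> U')) \<le> card (in_arcs E s t U) + card (in_arcs E s t U')"
proof -
  have c: "card (in_arcs E s t U) = (\<Sum>e\<in>E. of_bool (t e \<in> U \<and> s e \<notin> U))" for U
    using assms by (simp add: in_arcs_def Int_def)
  show ?thesis unfolding c sum.distrib[symmetric] by (intro sum_mono) auto
qed

text \<open>Edmonds' cut condition. For \<open>m = 1\<close> and edges with ends in \<open>W\<close>
  it says that \<open>E\<close> contains a spanning out-branching from \<open>r\<close>; branchings
  are represented by such edge sets rather than by trees.\<close>

definition rooted_conn :: "'v set \<Rightarrow> 'v \<Rightarrow> nat \<Rightarrow> 'e set \<Rightarrow> ('e \<Rightarrow> 'v) \<Rightarrow> ('e \<Rightarrow> 'v) \<Rightarrow> bool" where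
  "rooted_conn W r m E s t \<longleftrightarrow> (\<forall>U. U \<noteq> {} \<longrightarrow> U \<subseteq> W - {r} \<longrightarrow> m \<le> card (in_arcs E s t U))"

text \<open>Lovasz's argument: inside a minimal set \<open>U\<close> that is critical and not
  contained in \<open>T\<close>, take an edge from \<open>U \<inter> T\<close> to
  \<open>U - T\<close>. If it entered a tight set \<open>X\<close>, then \<open>U \<inter> X\<close>
  would be a smaller critical set.\<close>

lemma branching_grow:
  assumes fin: "finite W" "finite E" and W: "\<And>e. e \<in> E \<Longrightarrow> s e \<in> W \<and> t e \<in> W"
    and conn: "rooted_conn W r (Suc m) E s t"
    and T: "r \<in> T" "T \<subset> W" and F: "F \<subseteq> E" "\<And>e. e \<in> F \<Longrightarrow> s e \<in> T \<and> t e \<in> T"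
    and left: "rooted_conn W r m (E - F) s t"
  obtains e where "e \<in> E - F" "s e \<in> T" "t e \<in> W - T" "rooted_conn W r m (E - insert e F) s t"
proof -
  let ?d = "\<lambda>U. card (in_arcs (E - F) s t U)"
  define critical where "critical U \<longleftrightarrow> U \<subseteq> W \<and> \<not> U \<subseteq> T \<and> (U = W \<or> r \<notin> U \<and> ?d U = m)" for U
  have "critical W" using T by (auto simp: critical_def)
  moreover have "finite {U. critical U}"
    by (rule finite_subset[of _ "Pow W"]) (auto simp: critical_def fin)
  ultimately obtain U where U: "critical U" and min: "\<And>U'. critical U' \<Longrightarrow> U' \<subseteq> U \<Longrightarrow> U' = U"
    using finite_has_minimal2[of "{U. critical U}" W] by auto
  have finE: "finite (E - F)" using fin by simp
  have "\<exists>e\<in>E - F. s e \<in> U \<inter> T \<and> t e \<in> U - T"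
  proof (rule ccontr)
    assume none: "\<not> ?thesis"
    \<comment> \<open>Edges of \<open>F\<close> stay inside \<open>T\<close>, and by assumption no
      remaining edge reaches \<open>U - T\<close> from \<open>U \<inter> T\<close>; so
      \<open>U\<close> inherits the \<open>Suc m\<close> entering edges of
      \<open>U - T\<close>.\<close>
    have "in_arcs E s t (U - T) \<subseteq> in_arcs (E - F) s t (U - T)" using F(2) by (auto simp: in_arcs_def)
    also have "\<dots> \<subseteq> in_arcs (E - F) s t U" using none by (auto simp: in_arcs_def)
    finally have "card (in_arcs E s t (U - T)) \<le> ?d U"
      by (rule card_mono[rotated]) (simp add: in_arcs_def fin)
    moreover have "Suc m \<le> card (in_arcs E s t (U - T))"
    proof -
      have "U \<subseteq> W" "\<not> U \<subseteq> T" using U unfolding critical_def by simp_all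
      then have "U - T \<noteq> {}" "U - T \<subseteq> W - {r}" using T(1) by auto
      then show ?thesis using conn unfolding rooted_conn_def by simp
    qed
    ultimately have big: "Suc m \<le> ?d U" by simp
    have "in_arcs (E - F) s t W = {}" using W by (auto simp: in_arcs_def)
    then have "U \<noteq> W" using big by auto
    then have "?d U = m" using U unfolding critical_def by blast
    then show False using big by simp
  qed
  then obtain e where e: "e \<in> E - F" "s e \<in> U \<inter> T" "t e \<in> U - T" by blast
  have "rooted_conn W r m (E - insert e F) s t" unfolding rooted_conn_def
  proof (intro allI impI)
    fix X assume X: "X \<noteq> {}" "X \<subseteq> W - {r}"
    have le: "m \<le> ?d X" using left X by (simp add: rooted_conn_def)
    have eq: "in_arcs (E - insert e F) s t X = in_arcs (E - F) s t X - {e}" by (auto simp: in_arcs_def)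
    show "m \<le> card (in_arcs (E - insert e F) s t X)"
    proof (cases "e \<in> in_arcs (E - F) s t X \<and> ?d X = m")
      case False
      then show ?thesis unfolding eq using le finE by (auto simp: card_Diff_singleton_if in_arcs_def)
    next
      case True
      then have tX: "t e \<in> X" "s e \<notin> X" by (auto simp: in_arcs_def)
      have "critical (U \<inter> X)"
      proof (cases "U = W")
        case True
        then have "U \<inter> X = X" using X by auto
        moreover have "\<not> X \<subseteq> T" "r \<notin> X" "X \<subseteq> W" using X(2) tX(1) e(3) by blast+
        ultimately show ?thesis using \<open>e \<in> _ \<and> ?d X = m\<close> unfolding critical_def by simp
      next
        case False
        then have rU: "r \<notin> U" "?d U = m" "U \<subseteq> W" using U unfolding critical_def by blast+
        have "U \<inter> X \<noteq> {}" using tX(1) e(3) by blast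
        moreover have "U \<inter> X \<subseteq> W - {r}" "U \<union> X \<subseteq> W - {r}" using rU(1,3) X(2) by blast+
        ultimately have "m \<le> ?d (U \<inter> X)" "m \<le> ?d (U \<union> X)"
          using left X(1) unfolding rooted_conn_def by simp_all
        then have "?d (U \<inter> X) = m"
          using in_arcs_submodular[OF finE, of s t U X] True rU(2) by linarith
        moreover have "\<not> U \<inter> X \<subseteq> T" "r \<notin> U \<inter> X" "U \<inter> X \<subseteq> W" using tX(1) e(3) rU(1,3) by blast+
        ultimately show ?thesis unfolding critical_def by blast
      qed
      from min[OF this] show ?thesis using tX e by auto
    qed
  qed
  moreover have "U \<subseteq> W" using U unfolding critical_def by blast
  ultimately show ?thesis using e by (intro that[of e]) auto
qed

lemma branching_extend:
  assumes fin: "finite W" "finite E" and W: "\<And>e. e \<in> E \<Longrightarrow> s e \<in> W \<and> t e \<in> W"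
    and conn: "rooted_conn W r (Suc m) E s t"
    and "r \<in> T" "T \<subseteq> W" "F \<subseteq> E" "\<And>e. e \<in> F \<Longrightarrow> s e \<in> T \<and> t e \<in> T"
    and "rooted_conn W r m (E - F) s t" and "rooted_conn T r 1 F s t"
  shows "\<exists>F\<subseteq>E. rooted_conn W r 1 F s t \<and> rooted_conn W r m (E - F) s t"
  using assms(5-)
proof (induction "card (W - T)" arbitrary: T F rule: less_induct)
  case less
  show ?case
  proof (cases "T = W")
    case True
    then show ?thesis using less.prems by blast
  next
    case False
    then have T: "T \<subset> W" using less.prems by blast
    from branching_grow[OF fin W conn less.prems(1) T less.prems(3,4,5)] obtain e where
      e: "e \<in> E - F" "s e \<in> T" "t e \<in> W - T" "rooted_conn W r m (E - insert e F) s t" by blast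
    have finF: "finite F" using less.prems(3) fin(2) finite_subset by blast
    have "rooted_conn (insert (t e) T) r 1 (insert e F) s t" unfolding rooted_conn_def
    proof (intro allI impI)
      fix U assume U: "U \<noteq> {}" "U \<subseteq> insert (t e) T - {r}"
      have "in_arcs (insert e F) s t U \<noteq> {}"
      proof (cases "U \<inter> T = {}")
        case True
        then have "U = {t e}" using U by auto
        then show ?thesis using e by (auto simp: in_arcs_def)
      next
        case False
        moreover have "U \<inter> T \<subseteq> T - {r}" using U(2) by blast
        ultimately have "1 \<le> card (in_arcs F s t (U \<inter> T))" using less.prems(6) unfolding rooted_conn_def by simp
        then have "in_arcs F s t (U \<inter> T) \<noteq> {}" by auto
        then show ?thesis using less.prems(4) unfolding in_arcs_def by blast
      qed
      then show "1 \<le> card (in_arcs (insert e F) s t U)" using finF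
        by (simp add: in_arcs_def Suc_le_eq card_gt_0_iff)
    qed
    moreover have "card (W - insert (t e) T) < card (W - T)"
      using e fin by (intro psubset_card_mono) auto
    moreover have "r \<in> insert (t e) T" "insert (t e) T \<subseteq> W" "insert e F \<subseteq> E"
      using less.prems(1-3) e by simp_all
    moreover have "s x \<in> insert (t e) T \<and> t x \<in> insert (t e) T" if "x \<in> insert e F" for x
      using that less.prems(4)[of x] e(2) by blast
    ultimately show ?thesis using e(4) by (intro less.hyps[of "insert (t e) T" "insert e F"])
  qed
qed

theorem edmonds_branchings:
  assumes fin: "finite W" "finite E" and W: "\<And>e. e \<in> E \<Longrightarrow> s e \<in> W \<and> t e \<in> W" and r: "r \<in> W"
    and conn: "rooted_conn W r m E s t"
  shows "\<exists>F :: nat \<Rightarrow> 'e set. (\<forall>i<m. F i \<subseteq> E \<and> rooted_conn W r 1 (F i) s t) \<and>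
    (\<forall>i<m. \<forall>j<m. i \<noteq> j \<longrightarrow> F i \<inter> F j = {})"
  using fin(2) W conn
proof (induction m arbitrary: E)
  case 0
  then show ?case by simp
next
  case (Suc m)
  have "rooted_conn W r m (E - {}) s t" using Suc.prems(3) unfolding rooted_conn_def Diff_empty by (meson Suc_leD)
  moreover have "rooted_conn {r} r 1 {} s t" unfolding rooted_conn_def by auto
  ultimately have "\<exists>G\<subseteq>E. rooted_conn W r 1 G s t \<and> rooted_conn W r m (E - G) s t"
    using r by (intro branching_extend[OF fin(1) Suc.prems, of "{r}" "{}"]) simp_all
  then obtain G where G: "G \<subseteq> E" "rooted_conn W r 1 G s t" "rooted_conn W r m (E - G) s t" by blast
  have "finite (E - G)" using Suc.prems(1) by simp
  from Suc.IH[OF this _ G(3)] Suc.prems(2) obtain F where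
    F: "\<forall>i<m. F i \<subseteq> E - G \<and> rooted_conn W r 1 (F i) s t" "\<forall>i<m. \<forall>j<m. i \<noteq> j \<longrightarrow> F i \<inter> F j = {}"
    by (metis DiffD1)
  show ?case
  proof (intro exI[of _ "F(m := G)"] conjI allI impI)
    fix i j assume "i < Suc m" "j < Suc m" "i \<noteq> j"
    moreover have "F l \<inter> G = {}" if "l < m" for l using F(1) that by blast
    ultimately show "(F(m := G)) i \<inter> (F(m := G)) j = {}"
      using F(2) by (cases "i = m"; cases "j = m") (simp_all add: less_Suc_eq Int_commute)
  next
    fix i assume "i < Suc m"
    then show "(F(m := G)) i \<subseteq> E" "rooted_conn W r 1 ((F(m := G)) i) s t"
      using F(1) G by (cases "i = m"; simp add: less_Suc_eq; blast)+
  qed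
qed

text \<open>Equivalently, adding the reversals of \<open>J\<close> makes every vertex reachable from \<open>r\<close>.\<close>

definition covers_dicuts :: "'v set \<Rightarrow> 'a set \<Rightarrow> ('a \<Rightarrow> 'v) \<Rightarrow> ('a \<Rightarrow> 'v) \<Rightarrow> 'v \<Rightarrow> 'a set \<Rightarrow> bool" where
  "covers_dicuts V A s t r J \<longleftrightarrow>
     (\<forall>U. U \<noteq> {} \<longrightarrow> U \<subseteq> V - {r} \<longrightarrow> in_arcs A s t U = {} \<longrightarrow> J \<inter> out_arcs A s t U \<noteq> {})"

text \<open>With \<open>m\<close> copies, the forward arcs are never scarce, and only the reversals
  have to be shared. A set entered by no arc of \<open>A\<close> can be entered by a branching only
  through a reversal, so the reversals used by one branching cover the dicuts avoiding
  \<open>r\<close>.\<close>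

lemma pack_reversed_arcs:
  fixes V :: "'v set" and A :: "'a set"
  assumes D: "digraph V A s t" and r: "r \<in> V" and B: "B \<subseteq> A"
    and many: "\<And>U. U \<noteq> {} \<Longrightarrow> U \<subseteq> V - {r} \<Longrightarrow> in_arcs A s t U = {} \<Longrightarrow> m \<le> card (out_arcs A s t U \<inter> B)"
  shows "\<exists>J :: nat \<Rightarrow> 'a set. (\<forall>i<m. J i \<subseteq> B \<and> covers_dicuts V A s t r (J i)) \<and>
    (\<forall>i<m. \<forall>j<m. i \<noteq> j \<longrightarrow> J i \<inter> J j = {})"
proof -
  \<comment> \<open>Indices below \<open>m\<close> number the copies of an arc; the index
    \<open>m\<close> marks its reversal.\<close>
  define H where "H = A \<times> {..<m} \<union> B \<times> {m}"
  define s' t' where "s' = (\<lambda>(a, i). if i < m then s a else t a)"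
    and "t' = (\<lambda>(a, i). if i < m then t a else s a)"
  have fin: "finite V" "finite A" and ends: "\<And>a. a \<in> A \<Longrightarrow> s a \<in> V \<and> t a \<in> V"
    using D by (auto simp: digraph_def)
  have finH: "finite H" using fin B finite_subset[OF B] by (simp add: H_def)
  have conn: "rooted_conn V r m H s' t'" unfolding rooted_conn_def
  proof (intro allI impI)
    fix U assume U: "U \<noteq> {}" "U \<subseteq> V - {r}"
    have finI: "finite (in_arcs H s' t' U)" using finH by (simp add: in_arcs_def)
    show "m \<le> card (in_arcs H s' t' U)"
    proof (cases "in_arcs A s t U = {}")
      case True
      have "(\<lambda>a. (a, m)) ` (out_arcs A s t U \<inter> B) \<subseteq> in_arcs H s' t' U"
        by (auto simp: in_arcs_def out_arcs_def H_def s'_def t'_def)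
      then have "card ((\<lambda>a. (a, m)) ` (out_arcs A s t U \<inter> B)) \<le> card (in_arcs H s' t' U)"
        by (rule card_mono[OF finI])
      then show ?thesis using many[OF U True] by (simp add: card_image inj_on_def)
    next
      case False
      then obtain a where "a \<in> in_arcs A s t U" by blast
      then have "Pair a ` {..<m} \<subseteq> in_arcs H s' t' U"
        by (auto simp: in_arcs_def H_def s'_def t'_def)
      then have "card (Pair a ` {..<m}) \<le> card (in_arcs H s' t' U)" by (rule card_mono[OF finI])
      then show ?thesis by (simp add: card_image inj_on_def)
    qed
  qed
  have endsH: "s' e \<in> V \<and> t' e \<in> V" if e: "e \<in> H" for e
  proof -
    obtain a i where ai: "e = (a, i)" by (cases e)
    then have "a \<in> A" using e B by (auto simp: H_def)
    then show ?thesis using ends by (simp add: ai s'_def t'_def)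
  qed
  from edmonds_branchings[OF fin(1) finH endsH r conn] obtain F where
    F: "\<forall>i<m. F i \<subseteq> H \<and> rooted_conn V r 1 (F i) s' t'"
    "\<forall>i<m. \<forall>j<m. i \<noteq> j \<longrightarrow> F i \<inter> F j = {}" by blast
  show ?thesis
  proof (intro exI[of _ "\<lambda>i. {a. (a, m) \<in> F i}"] conjI allI impI)
    fix i assume i: "i < m"
    then show "{a. (a, m) \<in> F i} \<subseteq> B" using F(1) by (auto simp: H_def)
    show "covers_dicuts V A s t r {a. (a, m) \<in> F i}" unfolding covers_dicuts_def
    proof (intro allI impI)
      fix U assume U: "U \<noteq> {}" "U \<subseteq> V - {r}" "in_arcs A s t U = {}"
      have "1 \<le> card (in_arcs (F i) s' t' U)" using F(1) i U(1,2) unfolding rooted_conn_def by simp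
      then have "in_arcs (F i) s' t' U \<noteq> {}" by auto
      then obtain a l where al: "(a, l) \<in> F i" "t' (a, l) \<in> U" "s' (a, l) \<notin> U" by (auto simp: in_arcs_def)
      have H: "(a, l) \<in> H" using al F(1) i by blast
      have "\<not> l < m"
      proof
        assume "l < m"
        then have "a \<in> in_arcs A s t U" using al H B by (auto simp: in_arcs_def H_def s'_def t'_def)
        then show False using U(3) by blast
      qed
      then have "l = m" "a \<in> out_arcs A s t U" using al H B by (auto simp: out_arcs_def H_def s'_def t'_def)
      then show "{a. (a, m) \<in> F i} \<inter> out_arcs A s t U \<noteq> {}" using al by blast
    qed
  next
    fix i j assume "i < m" "j < m" "i \<noteq> j"
    then show "{a. (a, m) \<in> F i} \<inter> {a. (a, m) \<in> F j} = {}" using F(2) by blast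
  qed
qed

subsection \<open>Packing dijoins\<close>

text \<open>Balance gives \<open>p * card N \<le> (p + 1) * card P\<close>. Adding
  \<open>p * card P\<close> yields the share \<open>p / (2*p + 1)\<close>, the origin of the ratio
  in the theorem.\<close>

lemma positive_share:
  fixes f :: "'a \<Rightarrow> int" and p \<tau> :: nat
  assumes fin: "finite S" and f: "\<And>a. a \<in> S \<Longrightarrow> \<bar>f a\<bar> = int p \<or> \<bar>f a\<bar> = int p + 1" and p: "p > 0"
    and zero: "sum f S = 0" and \<tau>: "\<tau> \<le> card S"
  shows "\<tau> * p div (2 * p + 1) \<le> card {a\<in>S. f a > 0}"
proof -
  define P N where "P = {a\<in>S. f a > 0}" and "N = {a\<in>S. \<not> f a > 0}"
  have finPN: "finite P" "finite N" and S: "S = P \<union> N" "P \<inter> N = {}" using fin by (auto simp: P_def N_def)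
  have card: "card S = card P + card N" unfolding S(1) by (rule card_Un_disjoint[OF finPN S(2)])
  have "0 = sum f P + sum f N" using zero unfolding S(1) by (simp add: sum.union_disjoint[OF finPN S(2)])
  also have "sum f P \<le> int (card P) * (int p + 1)"
    using f by (intro sum_bounded_above) (force simp: P_def)
  also have "sum f N \<le> int (card N) * (- int p)"
    using f by (intro sum_bounded_above) (force simp: N_def)
  finally have "int p * int (card N) \<le> (int p + 1) * int (card P)" by (simp add: algebra_simps)
  then have "p * card N \<le> (p + 1) * card P" by (metis of_nat_1 of_nat_add of_nat_le_iff of_nat_mult)
  moreover have "\<tau> * p \<le> (card P + card N) * p" using \<tau> card by simp
  ultimately have "\<tau> * p \<le> card P * (2 * p + 1)" by (simp add: algebra_simps)
  then have "\<tau> * p div (2 * p + 1) \<le> card P * (2 * p + 1) div (2 * p + 1)" by (rule div_le_mono)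
  also have "\<dots> = card P" by (rule nonzero_mult_div_cancel_right) simp
  finally show ?thesis by (simp add: P_def)
qed

theorem theorem2:
  fixes V :: "'v set" and A :: "'a set" and tail head :: "'a \<Rightarrow> 'v" and p \<tau> :: nat
  assumes "p > 0"
    and "digraph V A tail head"
    and "min_dicut_size V A tail head \<tau>"
    and "underlying_k_edge_connected V A tail head (6 * p)"
  shows "\<exists>J :: nat \<Rightarrow> 'a set.
           (\<forall>i < (\<tau> * p) div (2 * p + 1). is_dijoin V A tail head (J i)) \<and>
           (\<forall>i < (\<tau> * p) div (2 * p + 1). \<forall>j < (\<tau> * p) div (2 * p + 1). i \<noteq> j \<longrightarrow> J i \<inter> J j = {})"
proof -
  define m where "m = \<tau> * p div (2 * p + 1)"
  have fin: "finite V" "finite A" and ends: "\<And>a. a \<in> A \<Longrightarrow> tail a \<in> V \<and> head a \<in> V \<and> tail a \<noteq> head a"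
    using assms(2) by (auto simp: digraph_def)
  obtain C where "is_dicut V A tail head C" using assms(3) unfolding min_dicut_size_def by blast
  then obtain r where r: "r \<in> V" unfolding is_dicut_def by auto
  have conn: "6 * int p \<le> cut A tail head U" if U: "U \<noteq> {}" "U \<subset> V" for U
  proof -
    have "{a\<in>A. (tail a \<in> U) \<noteq> (head a \<in> U)} = out_arcs A tail head U \<union> in_arcs A tail head U"
      by (auto simp: out_arcs_def in_arcs_def)
    then have "cut A tail head U = int (card (out_arcs A tail head U \<union> in_arcs A tail head U))"
      using fin(2) by (simp add: cut_def Int_def)
    moreover have "6 * p \<le> card (out_arcs A tail head U \<union> in_arcs A tail head U)"
      using assms(4) U unfolding underlying_k_edge_connected_def by simp
    ultimately show ?thesis by linarith
  qed
  obtain f where f: "\<And>a. a \<in> A \<Longrightarrow> \<bar>f a\<bar> = int p \<or> \<bar>f a\<bar> = int p + 1"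
    and flow: "\<And>v. v \<in> V \<Longrightarrow> net A tail head f v = 0"
    using circular_flow[OF fin(2,1) ends assms(1) conn] by metis
  define P N where "P = {a\<in>A. f a > 0}" and "N = {a\<in>A. - f a > 0}"
  have dicut: "m \<le> card (out_arcs A tail head U \<inter> P) \<and> m \<le> card (out_arcs A tail head U \<inter> N)"
    if U: "U \<noteq> {}" "U \<subset> V" "in_arcs A tail head U = {}" for U
  proof -
    let ?C = "out_arcs A tail head U"
    have finC: "finite ?C" and CA: "?C \<subseteq> A" using fin(2) by (auto simp: out_arcs_def)
    have "\<tau> \<le> card ?C" using assms(3) U unfolding min_dicut_size_def is_dicut_def by blast
    moreover have "sum f ?C = 0"
    proof -
      have "0 = (\<Sum>v\<in>U. net A tail head f v)" using flow U by (intro sum.neutral[symmetric]) auto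
      also have "\<dots> = (\<Sum>a\<in>A. f a * (of_bool (tail a \<in> U) - of_bool (head a \<in> U)))"
        using U fin finite_subset by (intro sum_net) blast
      also have "\<dots> = sum f ?C"
        using fin(2) U(3) by (intro sum.mono_neutral_cong_right) (auto simp: out_arcs_def in_arcs_def)
      finally show ?thesis by simp
    qed
    moreover have "?C \<inter> P = {a\<in>?C. f a > 0}" "?C \<inter> N = {a\<in>?C. - f a > 0}" using CA by (auto simp: P_def N_def)
    ultimately show ?thesis
      using positive_share[OF finC _ assms(1), of f \<tau>] positive_share[OF finC _ assms(1), of "\<lambda>a. - f a" \<tau>] f CA
      unfolding m_def by (simp add: sum_negf subset_iff)
  qed
  have rev: "in_arcs A head tail U = out_arcs A tail head U" "out_arcs A head tail U = in_arcs A tail head U" for U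
    by (auto simp: in_arcs_def out_arcs_def)
  have manyP: "m \<le> card (out_arcs A tail head U \<inter> P)"
    if U: "U \<noteq> {}" "U \<subseteq> V - {r}" "in_arcs A tail head U = {}" for U
  proof -
    have "U \<subset> V" using U(2) r by blast
    then show ?thesis using dicut[OF U(1) _ U(3)] by simp
  qed
  have "P \<subseteq> A" by (auto simp: P_def)
  from pack_reversed_arcs[OF assms(2) r this manyP] obtain J1 :: "nat \<Rightarrow> 'a set" where
    J1: "\<forall>i<m. J1 i \<subseteq> P \<and> covers_dicuts V A tail head r (J1 i)" "\<forall>i<m. \<forall>j<m. i \<noteq> j \<longrightarrow> J1 i \<inter> J1 j = {}"
    by blast
  \<comment> \<open>In-branchings are out-branchings of the reversed digraph, whose dicut shores are
    the complements of those of the original.\<close>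
  have manyN: "m \<le> card (out_arcs A head tail U \<inter> N)"
    if U: "U \<noteq> {}" "U \<subseteq> V - {r}" "in_arcs A head tail U = {}" for U
  proof -
    have "V - U \<noteq> {}" "V - U \<subset> V" using U(1,2) r by blast+
    moreover have "in_arcs A tail head (V - U) = {}" "out_arcs A tail head (V - U) = in_arcs A tail head U"
      using U(3) ends by (auto simp: in_arcs_def out_arcs_def)
    ultimately show ?thesis unfolding rev using dicut[of "V - U"] by simp
  qed
  have D': "digraph V A head tail" using fin ends unfolding digraph_def by (simp add: eq_sym_conv)
  have "N \<subseteq> A" by (auto simp: N_def)
  from pack_reversed_arcs[OF D' r this manyN] obtain J2 :: "nat \<Rightarrow> 'a set" where
    J2: "\<forall>i<m. J2 i \<subseteq> N \<and> covers_dicuts V A head tail r (J2 i)" "\<forall>i<m. \<forall>j<m. i \<noteq> j \<longrightarrow> J2 i \<inter> J2 j = {}"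
    by blast
  have "is_dijoin V A tail head (J1 i \<union> J2 i)" if i: "i < m" for i
    unfolding is_dijoin_def is_dicut_def
  proof (intro conjI allI impI)
    have "J1 i \<subseteq> P" "J2 i \<subseteq> N" using J1(1) J2(1) i by simp_all
    then show "J1 i \<union> J2 i \<subseteq> A" by (auto simp: P_def N_def)
    fix C assume "\<exists>U. U \<noteq> {} \<and> U \<subset> V \<and> in_arcs A tail head U = {} \<and> C = out_arcs A tail head U"
    then obtain U where U: "U \<noteq> {}" "U \<subset> V" "in_arcs A tail head U = {}" "C = out_arcs A tail head U" by blast
    show "(J1 i \<union> J2 i) \<inter> C \<noteq> {}"
    \<comment> \<open>Dicuts leaving a set without \<open>r\<close> are met by \<open>J1 i\<close>,
      those leaving a set with \<open>r\<close> by \<open>J2 i\<close>.\<close>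
    proof (cases "r \<in> U")
      case False
      then have "U \<subseteq> V - {r}" using U(2) by blast
      then have "J1 i \<inter> C \<noteq> {}" using J1(1) i U unfolding covers_dicuts_def by simp
      then show ?thesis by blast
    next
      case True
      then have "V - U \<noteq> {}" "V - U \<subseteq> V - {r}" using U(2) by blast+
      moreover have "in_arcs A head tail (V - U) = {}" "out_arcs A head tail (V - U) = C"
        using U(3,4) ends by (auto simp: in_arcs_def out_arcs_def)
      moreover have "covers_dicuts V A head tail r (J2 i)" using J2(1) i by simp
      ultimately have "J2 i \<inter> C \<noteq> {}" unfolding covers_dicuts_def by metis
      then show ?thesis by blast
    qed
  qed
  moreover have "(J1 i \<union> J2 i) \<inter> (J1 j \<union> J2 j) = {}" if ij: "i < m" "j < m" "i \<noteq> j" for i j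
  proof -
    have "P \<inter> N = {}" by (auto simp: P_def N_def)
    moreover have "J1 i \<subseteq> P" "J1 j \<subseteq> P" "J2 i \<subseteq> N" "J2 j \<subseteq> N" using J1(1) J2(1) ij by simp_all
    moreover have "J1 i \<inter> J1 j = {}" "J2 i \<inter> J2 j = {}" using J1(2) J2(2) ij by simp_all
    ultimately show ?thesis by blast
  qed
  ultimately show ?thesis unfolding m_def[symmetric] by (intro exI[of _ "\<lambda>i. J1 i \<union> J2 i"]) simp
qed

end
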